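(* Let $\widehat M$ and $M$ be Coxeter matrices of finite type over finite sets $\widehat I$ and $I$, and let $\Phi:\mathrm{Br}^+(\widehat M)\to\mathrm{Br}^+(M)$ be a light homomorphism of Artin monoids. Then $\Phi$ is parabolic.
   Context: A Coxeter matrix over a finite set $I$ is a symmetric matrix $M=(m_{ij})_{i,j\in I}$ with $m_{ii}=1$, $m_{ij}\in\mathbb Z_{\ge2}\cup\{\infty\}$ for $i\neq j$. The Artin monoid $\mathrm{Br}^+(M)$ is generated by $T_i$, $i\in I$, subject to $T_iT_jT_i\cdots=T_jT_iT_j\cdots$ ($m_{ij}$ factors on each side) for $i\ne j$, $m_{ij}<\infty$. $W(M)$ is the Coxeter group with simple generators $s_i$; $M$ is of finite type if $W(M)$ is finite. For $w\in W(M)$, $T_w:=T_{i_1}\cdots T_{i_k}$ for any reduced expression $w=s_{i_1}\cdots s_{i_k}$. For $K\subset I$, $W_K(M)=\langle s_k:k\in K\rangle$, $\mathrm{Br}^+_K(M)=\langle T_k:k\in K\rangle$; if $W_K(M)$ is finite, $w_\circ^K$ is its longest element, and $w_{J;K}=w_\circ^Jw_\circ^K$ for $J\subset K$. The Coxeter graph of $M$ has vertex set $I$ and an edge between $i,j$ iff $m_{ij}>2$; connected components of $K\subset I$ are those of the full subgraph on $K$. For $T\in\mathrm{Br}^+(M)$, $\mathrm{supp}\,T\subset I$ is the set of indices of generators occurring in any expression of $T$ as a product of generators. For a homomorphism $\Phi:\mathrm{Br}^+(\widehat M)\to\mathrm{Br}^+(M)$ put $[\Phi](i)=\mathrm{supp}\,\Phi(\widehat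 T_i)$, $i\in\widehat I$, and $[\Phi](\widehat J)=\bigcup_{j\in\widehat J}[\Phi](j)$ for $\widehat J\subset\widehat I$. $\Phi$ is light if $|[\Phi](i)|\le1$ for all $i\in\widehat I$ (i.e. each generator is mapped to a non-negative power of a generator). For $K$ with $W_K(M)$ finite and connected components $K_1,\dots,K_r$, let $\mathsf P(\mathrm{Br}^+_K(M))$ be the submonoid of $\mathrm{Br}^+_K(M)$ generated by all $T_{w_{J;K_i}}$, $1\le i\le r$, $J\subset K_i$. For $\widehat M$, $M$ of finite type, $\Phi$ is called parabolic if $\Phi(\mathsf P(\mathrm{Br}^+(\widehat M)))\subset\mathsf P(\mathrm{Br}^+_{[\Phi](\widehat I)}(M))$. *)

theory Defs
  imports "HOL-Algebra.Generated_Groups" "HOL-Library.Extended_Nat"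
begin

section \<open>Monoids given by generators and relations\<close>

text \<open>The elements of the monoid presented by generators \<open>X\<close> and relations \<open>R\<close> are the classes of
  words over \<open>X\<close> modulo the least congruence containing \<open>R\<close>; thus \<open>u \<in> w\<close> says that the word \<open>u\<close> is
  an expression of the element \<open>w\<close>.\<close>

inductive word_cong :: "'a set \<Rightarrow> ('a list \<times> 'a list) set \<Rightarrow> 'a list \<Rightarrow> 'a list \<Rightarrow> bool"
  for X R where
  base: "(u, v) \<in> R \<Longrightarrow> word_cong X R u v"
| refl: "u \<in> lists X \<Longrightarrow> word_cong X R u u"
| sym: "word_cong X R u v \<Longrightarrow> word_cong X R v u"
| trans: "word_cong X R u v \<Longrightarrow> word_cong X R v w \<Longrightarrow> word_cong X R u w"
| append: "word_cong X R u u' \<Longrightarrow> word_cong X R v v' \<Longrightarrow> word_cong X R (u @ v) (u' @ v')"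

definition word_class :: "'a set \<Rightarrow> ('a list \<times> 'a list) set \<Rightarrow> 'a list \<Rightarrow> 'a list set" where
  "word_class X R u = {v. word_cong X R u v}"

definition presented_monoid :: "'a set \<Rightarrow> ('a list \<times> 'a list) set \<Rightarrow> 'a list set monoid" where
  "presented_monoid X R =
    \<lparr>carrier = word_class X R ` lists X,
     mult = (\<lambda>A B. \<Union>u\<in>A. \<Union>v\<in>B. word_class X R (u @ v)),
     one = word_class X R []\<rparr>"

section \<open>Coxeter groups and Artin monoids\<close>

definition coxeter_matrix :: "'i set \<Rightarrow> ('i \<Rightarrow> 'i \<Rightarrow> enat) \<Rightarrow> bool" where
  "coxeter_matrix I m \<longleftrightarrow> finite I \<and>
    (\<forall>i\<in>I. \<forall>j\<in>I. m i j = m j i) \<and>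
    (\<forall>i\<in>I. m i i = 1) \<and>
    (\<forall>i\<in>I. \<forall>j\<in>I. i \<noteq> j \<longrightarrow> 2 \<le> m i j)"

text \<open>The alternating word \<open>i j i \<dots>\<close> with \<open>n\<close> letters.\<close>

primrec alt_word :: "nat \<Rightarrow> 'i \<Rightarrow> 'i \<Rightarrow> 'i list" where
  "alt_word 0 i j = []"
| "alt_word (Suc n) i j = i # alt_word n j i"

definition artin_rels :: "'i set \<Rightarrow> ('i \<Rightarrow> 'i \<Rightarrow> enat) \<Rightarrow> ('i list \<times> 'i list) set" where
  "artin_rels I m =
    {(alt_word n i j, alt_word n j i) | i j n. i \<in> I \<and> j \<in> I \<and> i \<noteq> j \<and> m i j = enat n}"

definition artin_monoid :: "'i set \<Rightarrow> ('i \<Rightarrow> 'i \<Rightarrow> enat) \<Rightarrow> 'i list set monoid" where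
  "artin_monoid I m = presented_monoid I (artin_rels I m)"

definition artin_class :: "'i set \<Rightarrow> ('i \<Rightarrow> 'i \<Rightarrow> enat) \<Rightarrow> 'i list \<Rightarrow> 'i list set" where
  "artin_class I m = word_class I (artin_rels I m)"

definition artin_gen :: "'i set \<Rightarrow> ('i \<Rightarrow> 'i \<Rightarrow> enat) \<Rightarrow> 'i \<Rightarrow> 'i list set" where
  "artin_gen I m i = artin_class I m [i]"

text \<open>The relations \<open>(s\<^sub>i s\<^sub>j)\<^bsup>m\<^esup> = 1\<close>. For \<open>i = j\<close> they read \<open>s\<^sub>i s\<^sub>i = 1\<close>, so no inverses of the generators
  are needed and the monoid with this presentation is the Coxeter group.\<close>

definition coxeter_rels :: "'i set \<Rightarrow> ('i \<Rightarrow> 'i \<Rightarrow> enat) \<Rightarrow> ('i list \<times> 'i list) set" where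
  "coxeter_rels I m =
    {(concat (replicate n [i, j]), []) | i j n. i \<in> I \<and> j \<in> I \<and> m i j = enat n}"

definition coxeter_group :: "'i set \<Rightarrow> ('i \<Rightarrow> 'i \<Rightarrow> enat) \<Rightarrow> 'i list set monoid" where
  "coxeter_group I m = presented_monoid I (coxeter_rels I m)"

definition coxeter_gen :: "'i set \<Rightarrow> ('i \<Rightarrow> 'i \<Rightarrow> enat) \<Rightarrow> 'i \<Rightarrow> 'i list set" where
  "coxeter_gen I m i = word_class I (coxeter_rels I m) [i]"

definition finite_type :: "'i set \<Rightarrow> ('i \<Rightarrow> 'i \<Rightarrow> enat) \<Rightarrow> bool" where
  "finite_type I m \<longleftrightarrow> finite (carrier (coxeter_group I m))"

definition coxeter_length :: "'i list set \<Rightarrow> nat" where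
  "coxeter_length w = (LEAST n. \<exists>u\<in>w. length u = n)"

definition reduced_expression :: "'i list \<Rightarrow> 'i list set \<Rightarrow> bool" where
  "reduced_expression u w \<longleftrightarrow> u \<in> w \<and> length u = coxeter_length w"

text \<open>\<open>T\<^sub>w\<close>; by Matsumoto's theorem the class does not depend on the reduced expression chosen.\<close>

definition artin_lift :: "'i set \<Rightarrow> ('i \<Rightarrow> 'i \<Rightarrow> enat) \<Rightarrow> 'i list set \<Rightarrow> 'i list set" where
  "artin_lift I m w = artin_class I m (SOME u. reduced_expression u w)"

definition coxeter_parabolic :: "'i set \<Rightarrow> ('i \<Rightarrow> 'i \<Rightarrow> enat) \<Rightarrow> 'i set \<Rightarrow> 'i list set set" where
  "coxeter_parabolic I m K = generate (coxeter_group I m) (coxeter_gen I m ` K)"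

text \<open>The longest element of \<open>W\<^sub>K\<close>; meaningful (and then unique) only if \<open>W\<^sub>K\<close> is finite.\<close>

definition longest_elt :: "'i set \<Rightarrow> ('i \<Rightarrow> 'i \<Rightarrow> enat) \<Rightarrow> 'i set \<Rightarrow> 'i list set" where
  "longest_elt I m K = arg_max coxeter_length (\<lambda>w. w \<in> coxeter_parabolic I m K)"

definition parabolic_elt :: "'i set \<Rightarrow> ('i \<Rightarrow> 'i \<Rightarrow> enat) \<Rightarrow> 'i set \<Rightarrow> 'i set \<Rightarrow> 'i list set" where
  "parabolic_elt I m J K = longest_elt I m J \<otimes>\<^bsub>coxeter_group I m\<^esub> longest_elt I m K"

definition coxeter_components :: "('i \<Rightarrow> 'i \<Rightarrow> enat) \<Rightarrow> 'i set \<Rightarrow> 'i set set" where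
  "coxeter_components m K = K // {(i, j). i \<in> K \<and> j \<in> K \<and> i \<noteq> j \<and> 2 < m i j}\<^sup>*"

section \<open>Light and parabolic homomorphisms\<close>

text \<open>\<open>P(Br\<^sup>+\<^sub>K(M))\<close>. The generators lie in \<open>Br\<^sup>+\<^sub>K(M)\<close>, so it makes no difference
  that the generated submonoid is taken inside \<open>Br\<^sup>+(M)\<close>.\<close>

definition parabolic_submonoid :: "'i set \<Rightarrow> ('i \<Rightarrow> 'i \<Rightarrow> enat) \<Rightarrow> 'i set \<Rightarrow> 'i list set set" where
  "parabolic_submonoid I m K =
    (\<lambda>H. submonoid H (artin_monoid I m)) hull
      {artin_lift I m (parabolic_elt I m J C) | J C. C \<in> coxeter_components m K \<and> J \<subseteq> C}"

definition artin_supp :: "'i list set \<Rightarrow> 'i set" where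
  "artin_supp T = (\<Union>u\<in>T. set u)"

text \<open>\<open>[\<Phi>](J)\<close>\<close>

definition hom_supp ::
  "'a set \<Rightarrow> ('a \<Rightarrow> 'a \<Rightarrow> enat) \<Rightarrow> ('a list set \<Rightarrow> 'b list set) \<Rightarrow> 'a set \<Rightarrow> 'b set" where
  "hom_supp I m \<Phi> J = (\<Union>j\<in>J. artin_supp (\<Phi> (artin_gen I m j)))"

definition light :: "'a set \<Rightarrow> ('a \<Rightarrow> 'a \<Rightarrow> enat) \<Rightarrow> ('a list set \<Rightarrow> 'b list set) \<Rightarrow> bool" where
  "light I m \<Phi> \<longleftrightarrow> (\<forall>i\<in>I. card (hom_supp I m \<Phi> {i}) \<le> 1)"

definition parabolic_hom ::
  "'a set \<Rightarrow> ('a \<Rightarrow> 'a \<Rightarrow> enat) \<Rightarrow> 'b set \<Rightarrow> ('b \<Rightarrow> 'b \<Rightarrow> enat) \<Rightarrow>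
    ('a list set \<Rightarrow> 'b list set) \<Rightarrow> bool" where
  "parabolic_hom Ih mh I m \<Phi> \<longleftrightarrow>
    \<Phi> ` parabolic_submonoid Ih mh Ih \<subseteq> parabolic_submonoid I m (hom_supp Ih mh \<Phi> Ih)"

end

theory Submission
  imports Defs Complex_Main "HOL-Library.Sublist"
begin

text \<open>
  Call \<open>X\<close> quasi-central for \<open>K\<close> if it is a product of letters of \<open>K\<close> and if for each \<open>a \<in> K\<close> there is
  \<open>b \<in> K\<close> with \<open>T\<^sub>a X = X T\<^sub>b\<close>. The elements \<open>\<Delta>\<^sub>J = T\<^sub>w\<close> with \<open>w\<close> longest in \<open>W\<^sub>J\<close> are quasi-central for
  \<open>J\<close>, and \<open>T\<^sub>a\<^sup>p X = X B\<close> with \<open>p > 0\<close> implies \<open>T\<^sub>a X = X T\<^sub>b\<close> for some \<open>b\<close>; hence a light homomorphism maps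
  quasi-central elements to quasi-central elements, without any case distinction on Coxeter types.
  If \<open>X\<close> is quasi-central for \<open>K\<close>, then the set of its divisors among the generators in \<open>K\<close> is closed under
  adjacency in the Coxeter graph of \<open>K\<close>.

  Since \<open>\<Delta>\<^sub>J T\<^sub>w = \<Delta>\<^sub>C\<close> for \<open>w = w\<^bsub>J;C\<^esub>\<close>, it suffices to consider \<open>Y Z = D\<close> with \<open>D\<close> quasi-central
  for \<open>K\<close> and \<open>Y\<close> quasi-central for a subset \<open>S\<close>, and to show that \<open>Z\<close> lies in the parabolic submonoid.
  Choose a component \<open>C\<close> of \<open>K\<close> all of whose generators divide \<open>D\<close>, and let \<open>S'\<close> be the set of those
  \<open>s \<in> C \<inter> S\<close> that do not divide \<open>Z\<close>. Then \<open>\<Delta>\<^sub>C\<close> divides \<open>\<Delta>\<^bsub>S'\<^esub> Z\<close>, so that \<open>Z\<close> is the parabolic element of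
  \<open>S' \<subseteq> C\<close> times some \<open>Z'\<close>, while \<open>Y = Y' \<Delta>\<^bsub>S'\<^esub>\<close>. Cancelling \<open>\<Delta>\<^sub>C\<close> from \<open>D = Y' \<Delta>\<^sub>C Z'\<close> leaves a shorter instance.

  The monoid facts (cancellation, least common multiples) come from the Coxeter group: if \<open>a X = b Y\<close>, then \<open>X\<close>
  and \<open>Y\<close> continue the two sides of the braid relation between \<open>a\<close> and \<open>b\<close>. This is proved by induction on the
  length; transitivity along \<open>a, b, c\<close> is checked on reduced words below the longest element.
\<close>

section \<open>Words modulo the Artin and the Coxeter relations\<close>

declare in_listsD [rule del] in_listsI [rule del]

lemma rev_in_lists [simp]: "rev u \<in> lists X \<longleftrightarrow> u \<in> lists X"
  by (simp add: in_lists_conv_set)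

lemma length_alt_word [simp]: "length (alt_word n i j) = n"
  by (induction n arbitrary: i j) auto

lemma set_alt_word_subset: "set (alt_word n i j) \<subseteq> {i, j}"
  by (induction n arbitrary: i j) auto

lemma set_alt_word: "2 \<le> n \<Longrightarrow> set (alt_word n i j) = {i, j}"
  using set_alt_word_subset[of "n - 2" i j]
  by (cases n; cases "n - 1") auto

lemma alt_word_add:
  "alt_word (k + l) i j = alt_word k i j @ (if even k then alt_word l i j else alt_word l j i)"
  by (induction k arbitrary: i j) auto

lemma alt_word_snoc: "alt_word (Suc n) i j = alt_word n i j @ [if even n then i else j]"
  using alt_word_add[of n 1 i j] by auto

lemma rev_alt_word: "rev (alt_word n i j) = (if odd n then alt_word n i j else alt_word n j i)"
  by (induction n arbitrary: i j) (auto simp: alt_word_snoc simp del: alt_word.simps(2) simp flip: alt_word.simps(2))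

lemma alt_word_even: "alt_word (2 * n) i j = concat (replicate n [i, j])"
  by (induction n) auto

text \<open>Links the two forms of the defining relation: reversal is inversion in the group, so the
  two alternating words with \<open>n\<close> letters agree there iff the one with
  \<open>2 * n\<close> letters is trivial.\<close>

lemma alt_word_rev: "alt_word n i j @ rev (alt_word n j i) = alt_word (2 * n) i j"
  using alt_word_add[of n n i j] by (auto simp: rev_alt_word mult_2)

lemma alt_word_Cons: "0 < n \<Longrightarrow> alt_word n i j = i # alt_word (n - 1) j i"
  by (cases n) auto

lemma word_cong_lists:
  assumes "word_cong X R u v" "R \<subseteq> lists X \<times> lists X"
  shows "u \<in> lists X \<and> v \<in> lists X"
  using assms by induction auto

locale coxeter =
  fixes I :: "'i set" and m :: "'i \<Rightarrow> 'i \<Rightarrow> enat"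
  assumes coxeter_matrix: "coxeter_matrix I m"
begin

abbreviation acong (infix "\<sim>\<^sub>A" 50) where "u \<sim>\<^sub>A v \<equiv> word_cong I (artin_rels I m) u v"
abbreviation ccong (infix "\<sim>\<^sub>C" 50) where "u \<sim>\<^sub>C v \<equiv> word_cong I (coxeter_rels I m) u v"

lemma finite_I: "finite I" and m_sym: "i \<in> I \<Longrightarrow> j \<in> I \<Longrightarrow> m i j = m j i"
  and m_diag: "i \<in> I \<Longrightarrow> m i i = 1" and m_ge2: "i \<in> I \<Longrightarrow> j \<in> I \<Longrightarrow> i \<noteq> j \<Longrightarrow> 2 \<le> m i j"
  using coxeter_matrix unfolding coxeter_matrix_def by auto

lemma m_ge2_nat: "i \<in> I \<Longrightarrow> j \<in> I \<Longrightarrow> i \<noteq> j \<Longrightarrow> m i j = enat n \<Longrightarrow> 2 \<le> n"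
  using m_ge2[of i j] by (simp add: numeral_eq_enat)

lemma alt_word_lists [simp]: "i \<in> I \<Longrightarrow> j \<in> I \<Longrightarrow> alt_word n i j \<in> lists I"
  using set_alt_word_subset[of n i j] by (auto simp: in_lists_conv_set)

lemma artin_rels_lists: "artin_rels I m \<subseteq> lists I \<times> lists I"
  unfolding artin_rels_def by auto

lemma coxeter_rels_lists: "coxeter_rels I m \<subseteq> lists I \<times> lists I"
  unfolding coxeter_rels_def by (auto simp flip: alt_word_even)

lemma A_lists: "u \<sim>\<^sub>A v \<Longrightarrow> u \<in> lists I" "u \<sim>\<^sub>A v \<Longrightarrow> v \<in> lists I"
  using word_cong_lists[OF _ artin_rels_lists] by auto

lemma C_lists: "u \<sim>\<^sub>C v \<Longrightarrow> u \<in> lists I" "u \<sim>\<^sub>C v \<Longrightarrow> v \<in> lists I"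
  using word_cong_lists[OF _ coxeter_rels_lists] by auto

lemmas A_sym = word_cong.sym[where R = "artin_rels I m" and X = I]
lemmas C_sym = word_cong.sym[where R = "coxeter_rels I m" and X = I]
lemmas A_trans [trans] = word_cong.trans[where R = "artin_rels I m" and X = I]
lemmas C_trans [trans] = word_cong.trans[where R = "coxeter_rels I m" and X = I]
lemmas A_refl = word_cong.refl[where R = "artin_rels I m" and X = I]
lemmas C_refl = word_cong.refl[where R = "coxeter_rels I m" and X = I]
lemmas A_append = word_cong.append[where R = "artin_rels I m" and X = I]
lemmas C_append = word_cong.append[where R = "coxeter_rels I m" and X = I]

lemma A_left: "u \<sim>\<^sub>A v \<Longrightarrow> p \<in> lists I \<Longrightarrow> p @ u \<sim>\<^sub>A p @ v"
  by (rule A_append[OF A_refl])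

lemma A_right: "u \<sim>\<^sub>A v \<Longrightarrow> p \<in> lists I \<Longrightarrow> u @ p \<sim>\<^sub>A v @ p"
  by (rule A_append[OF _ A_refl])

lemma A_Cons: "u \<sim>\<^sub>A v \<Longrightarrow> a \<in> I \<Longrightarrow> a # u \<sim>\<^sub>A a # v"
  using A_left[of u v "[a]"] by auto

lemma C_left: "u \<sim>\<^sub>C v \<Longrightarrow> p \<in> lists I \<Longrightarrow> p @ u \<sim>\<^sub>C p @ v"
  by (rule C_append[OF C_refl])

lemma C_right: "u \<sim>\<^sub>C v \<Longrightarrow> p \<in> lists I \<Longrightarrow> u @ p \<sim>\<^sub>C v @ p"
  by (rule C_append[OF _ C_refl])

lemma C_Cons: "u \<sim>\<^sub>C v \<Longrightarrow> a \<in> I \<Longrightarrow> a # u \<sim>\<^sub>C a # v"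
  using C_left[of u v "[a]"] by auto

lemma C_square: "a \<in> I \<Longrightarrow> [a, a] \<sim>\<^sub>C []"
  by (rule word_cong.base)
    (auto simp: coxeter_rels_def m_diag one_enat_def intro!: exI[of _ a] exI[of _ "1::nat"])

lemma C_cancel2: "a \<in> I \<Longrightarrow> u \<in> lists I \<Longrightarrow> a # a # u \<sim>\<^sub>C u"
  using C_right[OF C_square, of a u] by auto

lemma C_rev_right: "u \<in> lists I \<Longrightarrow> u @ rev u \<sim>\<^sub>C []"
proof (induction u)
  case (Cons a u)
  have "[a] @ (u @ rev u) @ [a] \<sim>\<^sub>C [a] @ [] @ [a]"
    using Cons by (intro C_left C_right) auto
  also have "[a] @ [] @ [a] \<sim>\<^sub>C []" using Cons C_square by auto
  finally show ?case by simp
qed (auto intro: C_refl)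

lemma C_rev_left: "u \<in> lists I \<Longrightarrow> rev u @ u \<sim>\<^sub>C []"
  using C_rev_right[of "rev u"] by auto

lemma C_cancel_rev: "u \<in> lists I \<Longrightarrow> v \<in> lists I \<Longrightarrow> u @ rev u @ v \<sim>\<^sub>C v"
    "u \<in> lists I \<Longrightarrow> v \<in> lists I \<Longrightarrow> rev u @ u @ v \<sim>\<^sub>C v"
  using C_right[OF C_rev_right, of u v] C_right[OF C_rev_left, of u v] by auto

lemma C_left_iff:
  assumes "p \<in> lists I" "u \<in> lists I" "v \<in> lists I"
  shows "p @ u \<sim>\<^sub>C p @ v \<longleftrightarrow> u \<sim>\<^sub>C v"
proof
  assume "p @ u \<sim>\<^sub>C p @ v"
  then have "rev p @ p @ u \<sim>\<^sub>C rev p @ p @ v" using assms by (simp add: C_left)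
  then show "u \<sim>\<^sub>C v" using C_cancel_rev(2)[of p] assms C_sym C_trans by meson
qed (use assms C_left in auto)

lemma C_Cons_iff: "a \<in> I \<Longrightarrow> u \<in> lists I \<Longrightarrow> v \<in> lists I \<Longrightarrow> a # u \<sim>\<^sub>C a # v \<longleftrightarrow> u \<sim>\<^sub>C v"
  using C_left_iff[of "[a]" u v] by auto

lemma C_Cons_move:
  assumes "a \<in> I" "u \<in> lists I" "v \<in> lists I"
  shows "a # u \<sim>\<^sub>C v \<longleftrightarrow> u \<sim>\<^sub>C a # v"
  using C_Cons_iff[of a u "a # v"] C_cancel2[of a v] assms C_sym C_trans
  by (metis Cons_in_lists_iff)

text \<open>Every generator is an involution, so \<open>rev u\<close> represents the inverse of
  \<open>u\<close>.\<close>

lemma C_rev: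
  assumes "u \<sim>\<^sub>C v" shows "rev u \<sim>\<^sub>C rev v"
proof -
  have l: "u \<in> lists I" "v \<in> lists I" using C_lists assms by auto
  have "rev u @ u @ rev v \<sim>\<^sub>C rev u @ v @ rev v" using l assms by (intro C_left C_right) auto
  moreover have "rev u @ u @ rev v \<sim>\<^sub>C rev v" using C_cancel_rev(2) l by auto
  moreover have "rev u @ v @ rev v \<sim>\<^sub>C rev u" using C_left[OF C_rev_right[of v], of "rev u"] l by auto
  ultimately show ?thesis using C_sym C_trans by meson
qed

lemma C_right_iff:
  assumes "p \<in> lists I" "u \<in> lists I" "v \<in> lists I"
  shows "u @ p \<sim>\<^sub>C v @ p \<longleftrightarrow> u \<sim>\<^sub>C v"
proof
  assume "u @ p \<sim>\<^sub>C v @ p"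
  from C_rev[OF this] have "rev p @ rev u \<sim>\<^sub>C rev p @ rev v" by auto
  then have "rev u \<sim>\<^sub>C rev v" using C_left_iff[of "rev p" "rev u" "rev v"] assms by auto
  from C_rev[OF this] show "u \<sim>\<^sub>C v" by auto
qed (use assms C_right in auto)

lemma C_even_length: "u \<sim>\<^sub>C v \<Longrightarrow> even (length u) = even (length v)"
proof (induction rule: word_cong.induct)
  case (base u v)
  then show ?case by (auto simp: coxeter_rels_def simp flip: alt_word_even)
qed auto

lemma C_relation:
  assumes "i \<in> I" "j \<in> I" "m i j = enat n"
  shows "alt_word (2 * n) i j \<sim>\<^sub>C []"
  by (rule word_cong.base) (use assms in \<open>auto simp: coxeter_rels_def alt_word_even\<close>)

lemma C_alt_swap:
  assumes "i \<in> I" "j \<in> I" "m i j = enat n"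
  shows "alt_word n i j \<sim>\<^sub>C alt_word n j i"
proof -
  have "alt_word (2 * n) i j \<sim>\<^sub>C []"
    by (rule C_relation[OF assms])
  then have "alt_word n i j @ rev (alt_word n j i) \<sim>\<^sub>C alt_word n j i @ rev (alt_word n j i)"
    unfolding alt_word_rev using C_rev_right[of "alt_word n j i"] assms C_trans C_sym by (metis alt_word_lists)
  then show ?thesis using C_right_iff assms by auto
qed

lemma A_imp_C: "u \<sim>\<^sub>A v \<Longrightarrow> u \<sim>\<^sub>C v"
proof (induction rule: word_cong.induct)
  case (base u v)
  then show ?case using C_alt_swap by (auto simp: artin_rels_def)
next
  case (refl u)
  then show ?case by (rule C_refl)
next
  case (sym u v)
  from sym.IH show ?case by (rule C_sym)
next
  case (trans u v w)
  then show ?case by (metis C_trans)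
next
  case (append u u' v v')
  from append.IH show ?case by (rule C_append)
qed

lemma A_length: "u \<sim>\<^sub>A v \<Longrightarrow> length u = length v"
  by (induction rule: word_cong.induct) (auto simp: artin_rels_def)

text \<open>Both sides of a braid relation use exactly the letters \<open>i\<close> and
  \<open>j\<close>, because \<open>2 \<le> n\<close>. Hence the support of a monoid element can be
  read off from any of its expressions.\<close>

lemma A_set: "u \<sim>\<^sub>A v \<Longrightarrow> set u = set v"
proof (induction rule: word_cong.induct)
  case (base u v)
  then show ?case using m_ge2_nat by (auto simp: artin_rels_def set_alt_word)
qed auto

lemma A_alt: "i \<in> I \<Longrightarrow> j \<in> I \<Longrightarrow> i \<noteq> j \<Longrightarrow> m i j = enat n \<Longrightarrow> alt_word n i j \<sim>\<^sub>A alt_word n j i"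
  by (rule word_cong.base) (auto simp: artin_rels_def)

lemma A_rev: "u \<sim>\<^sub>A v \<Longrightarrow> rev u \<sim>\<^sub>A rev v"
proof (induction rule: word_cong.induct)
  case (base u v)
  then obtain i j n where "i \<in> I" "j \<in> I" "i \<noteq> j" "m i j = enat n"
      "u = alt_word n i j" "v = alt_word n j i" by (auto simp: artin_rels_def)
  then show ?case using A_alt[of i j n] A_sym by (auto simp: rev_alt_word)
next
  case (refl u)
  then show ?case by (auto intro: A_refl)
next
  case (sym u v)
  from sym.IH show ?case by (rule A_sym)
next
  case (trans u v w)
  then show ?case by (metis A_trans)
next
  case (append u u' v v')
  then show ?case using A_append[of "rev v" "rev v'" "rev u" "rev u'"] by simp
qed

end

section \<open>Orders of products of two generators, and the exchange condition\<close>

text \<open>Multiplication by \<open>2 * sin \<theta>\<close> turns each term into a difference of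
  cosines, so that the sum telescopes; the two end terms differ by a full period.\<close>

lemma sum_sin_period:
  fixes \<theta> \<phi> :: real
  assumes "sin \<theta> \<noteq> 0" "2 * real n * \<theta> = 2 * pi"
  shows "(\<Sum>t<n. sin (2 * real t * \<theta> + \<phi>)) = 0"
proof -
  have "2 * sin \<theta> * (\<Sum>t<k. sin (2 * real t * \<theta> + \<phi>)) = cos (\<phi> - \<theta>) - cos (2 * real k * \<theta> + \<phi> - \<theta>)" for k
  proof (induction k)
    case (Suc k)
    define x where "x = 2 * real k * \<theta> + \<phi>"
    have "2 * sin \<theta> * sin x = cos (x - \<theta>) - cos (x + \<theta>)"
      by (simp add: cos_add cos_diff)
    moreover have "2 * real (Suc k) * \<theta> + \<phi> - \<theta> = x + \<theta>"
      by (simp add: x_def algebra_simps)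
    ultimately show ?case using Suc by (simp add: x_def algebra_simps)
  qed simp
  from this[of n] have "2 * sin \<theta> * (\<Sum>t<n. sin (2 * real t * \<theta> + \<phi>)) = cos (\<phi> - \<theta>) - cos (\<phi> - \<theta> + 2 * pi)"
    unfolding assms(2) by (simp add: algebra_simps)
  then show ?thesis using assms(1) by simp
qed

section \<open>The numbers game, orders of products of two generators, and inversion parity\<close>

context coxeter
begin

text \<open>The contragredient of the geometric representation of the Coxeter group, played as Mozes's numbers game.\<close>

definition coupling :: "'i \<Rightarrow> 'i \<Rightarrow> real" where
  "coupling i j = (case m i j of enat n \<Rightarrow> 2 * cos (pi / n) | \<infinity> \<Rightarrow> 2)"

definition fire :: "'i \<Rightarrow> ('i \<Rightarrow> real) \<Rightarrow> 'i \<Rightarrow> real" where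
  "fire i f = (\<lambda>k. if k = i then - f i else f k + coupling i k * f i)"

primrec play :: "'i list \<Rightarrow> ('i \<Rightarrow> real) \<Rightarrow> 'i \<Rightarrow> real" where
  "play [] f = f"
| "play (i # u) f = play u (fire i f)"

lemma play_append: "play (u @ v) f = play v (play u f)"
  by (induction u arbitrary: f) auto

lemma fire_fire: "fire i (fire i f) = f"
  by (auto simp: fire_def)

text \<open>\<open>V (t + 1)\<close> is the value fired in step \<open>t\<close> when \<open>i\<close> and \<open>j\<close> fire alternately.\<close>

lemma play_alt_word:
  assumes ij: "i \<in> I" "j \<in> I" "i \<noteq> j"
    and V: "V 0 = - f j" "V 1 = f i" "\<And>t. V (t + 2) = coupling i j * V (t + 1) - V t"
  shows "play (alt_word (2 * k) i j) f i = V (2 * k + 1)"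
    and "play (alt_word (2 * k) i j) f j = - V (2 * k)"
    and "l \<noteq> i \<Longrightarrow> l \<noteq> j \<Longrightarrow> play (alt_word (2 * k) i j) f l =
      f l + coupling i l * (\<Sum>t<k. V (2 * t + 1)) + coupling j l * (\<Sum>t<k. V (2 * t + 2))"
proof -
  have sym: "coupling j i = coupling i j" using m_sym[of i j] ij by (simp add: coupling_def)
  have step: "play (alt_word (2 * Suc k) i j) f = fire j (fire i (play (alt_word (2 * k) i j) f))" for k
    unfolding alt_word_even
    by (induction k arbitrary: f) (auto simp: play_append)
  have main: "play (alt_word (2 * k) i j) f i = V (2 * k + 1) \<and> play (alt_word (2 * k) i j) f j = - V (2 * k)
      \<and> (\<forall>l. l \<noteq> i \<longrightarrow> l \<noteq> j \<longrightarrow> play (alt_word (2 * k) i j) f l =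
      f l + coupling i l * (\<Sum>t<k. V (2 * t + 1)) + coupling j l * (\<Sum>t<k. V (2 * t + 2)))" for k
  proof (induction k)
    case 0
    then show ?case using V by simp
  next
    case (Suc k)
    have v: "V (2 * k + 2) = coupling i j * V (2 * k + 1) - V (2 * k)"
        "V (2 * k + 3) = coupling i j * V (2 * k + 2) - V (2 * k + 1)"
      using V(3)[of "2 * k"] V(3)[of "2 * k + 1"] by (simp_all add: numeral_3_eq_3)
    define g where "g = play (alt_word (2 * k) i j) f"
    have g: "g i = V (2 * k + 1)" "g j = - V (2 * k)"
      "\<And>l. l \<noteq> i \<Longrightarrow> l \<noteq> j \<Longrightarrow> g l = f l + coupling i l * (\<Sum>t<k. V (2 * t + 1)) + coupling j l * (\<Sum>t<k. V (2 * t + 2))"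
      using Suc by (auto simp: g_def)
    have e: "2 * Suc k + 1 = 2 * k + 3" "2 * Suc k = 2 * k + 2" by auto
    have gj: "fire i g j = V (2 * k + 2)" using ij v g by (simp add: fire_def)
    have gi: "fire i g i = - V (2 * k + 1)" using ij v g by (simp add: fire_def)
    define h where "h = fire i g"
    have h: "h i = - V (2 * k + 1)" "h j = V (2 * k + 2)"
      "\<And>l. l \<noteq> i \<Longrightarrow> l \<noteq> j \<Longrightarrow> h l = g l + coupling i l * V (2 * k + 1)"
      using gi gj g by (auto simp: h_def fire_def)
    have "fire j h i = V (2 * k + 3)" using ij h v by (simp add: fire_def sym)
    moreover have "fire j h j = - V (2 * k + 2)" using h by (simp add: fire_def)
    moreover have "fire j h l = f l + coupling i l * (\<Sum>t<Suc k. V (2 * t + 1)) + coupling j l * (\<Sum>t<Suc k. V (2 * t + 2))"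
      if "l \<noteq> i" "l \<noteq> j" for l
      unfolding sum.lessThan_Suc distrib_left using that h g by (simp add: fire_def)
    moreover have "2 * k + 2 + 1 = 2 * k + 3" by simp
    ultimately show ?case unfolding step g_def[symmetric] h_def[symmetric] unfolding e by metis
  qed
  show "play (alt_word (2 * k) i j) f i = V (2 * k + 1)"
    "play (alt_word (2 * k) i j) f j = - V (2 * k)"
    "l \<noteq> i \<Longrightarrow> l \<noteq> j \<Longrightarrow> play (alt_word (2 * k) i j) f l =
      f l + coupling i l * (\<Sum>t<k. V (2 * t + 1)) + coupling j l * (\<Sum>t<k. V (2 * t + 2))"
    using main[of k] by auto
qed

text \<open>The closed solution of the recursion for the fired values:
  \<open>sin (t * \<theta>)\<close> and \<open>sin (t * \<theta> - \<theta>)\<close> with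
  \<open>\<theta> = pi / n\<close> both satisfy it, and the coefficients are fitted to
  \<open>V 0\<close> and \<open>V 1\<close>.\<close>

lemma fired_values_finite:
  fixes x y :: real
  assumes "m i j = enat n" and s: "sin (pi / n) \<noteq> 0"
  defines "V \<equiv> \<lambda>t::nat. (sin (t * (pi / n)) * x + sin (t * (pi / n) - pi / n) * y) / sin (pi / n)"
  shows "V 0 = - y" "V 1 = x" "V (t + 2) = coupling i j * V (t + 1) - V t"
proof -
  define \<theta> where "\<theta> = pi / real n"
  note [simp] = \<theta>_def[symmetric]
  have r: "sin (p + \<theta>) = 2 * cos \<theta> * sin p - sin (p - \<theta>)" for p
    by (simp add: sin_add sin_diff)
  show "V 0 = - y" "V 1 = x" using s by (auto simp: V_def)
  have "sin (real (t + 2) * \<theta>) = 2 * cos \<theta> * sin (real (t + 1) * \<theta>) - sin (t * \<theta>)"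
    using r[of "real (t + 1) * \<theta>"] by (simp add: algebra_simps)
  moreover have "sin (real (t + 2) * \<theta> - \<theta>) = 2 * cos \<theta> * sin (real (t + 1) * \<theta> - \<theta>) - sin (t * \<theta> - \<theta>)"
    using r[of "real t * \<theta>"] by (simp add: algebra_simps)
  moreover have "coupling i j = 2 * cos \<theta>" using assms by (simp add: coupling_def)
  moreover have "((2 * c * a - b) * x + (2 * c * a' - b') * y) / z = 2 * c * ((a * x + a' * y) / z) - (b * x + b' * y) / z"
    for a b a' b' c z :: real by (simp add: algebra_simps add_divide_distrib diff_divide_distrib)
  ultimately show "V (t + 2) = coupling i j * V (t + 1) - V t" unfolding V_def \<theta>_def[symmetric] by presburger
qed

lemma sin_pi_div_nonzero: "2 \<le> n \<Longrightarrow> sin (pi / real n) \<noteq> 0"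
  using sin_gt_zero[of "pi / real n"] by (auto simp: field_simps)

text \<open>The fired values have period \<open>2 * n\<close>, which restores the values at
  \<open>i\<close> and \<open>j\<close>. Every other vertex accumulates sums of fired values over a
  full turn, and these vanish by \<open>sum_sin_period\<close>.\<close>

lemma play_relation:
  assumes "i \<in> I" "j \<in> I" "m i j = enat n"
  shows "play (alt_word (2 * n) i j) f = f"
proof (cases "i = j")
  case True
  then have "n = 1" using assms m_diag[of i] by (simp add: one_enat_def)
  then show ?thesis using True by (simp add: numeral_2_eq_2 fire_fire)
next
  case False
  define \<theta> where "\<theta> = pi / real n"
  have n: "2 \<le> n" using m_ge2_nat assms False by blast
  have s: "sin \<theta> \<noteq> 0" using sin_pi_div_nonzero n by (simp add: \<theta>_def)
  have th: "2 * real n * \<theta> = 2 * pi" using n by (simp add: \<theta>_def)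
  define V where "V = (\<lambda>t::nat. (sin (t * \<theta>) * f i + sin (t * \<theta> - \<theta>) * f j) / sin \<theta>)"
  have V: "V 0 = - f j" "V 1 = f i" "\<And>t. V (t + 2) = coupling i j * V (t + 1) - V t"
    using fired_values_finite[OF assms(3), where x = "f i" and y = "f j"] s unfolding V_def \<theta>_def by blast+
  have per: "V (2 * n + t) = V t" for t
  proof -
    have "real (2 * n + t) * \<theta> = t * \<theta> + 2 * pi" using th by (simp add: algebra_simps)
    moreover have "t * \<theta> + 2 * pi - \<theta> = (t * \<theta> - \<theta>) + 2 * pi" by simp
    ultimately show ?thesis unfolding V_def by (metis sin_periodic)
  qed
  have sum0: "(\<Sum>t<n. V (2 * t + c)) = 0" for c
  proof -
    have "(\<Sum>t<n. V (2 * t + c)) =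
      ((\<Sum>t<n. sin (2 * real t * \<theta> + c * \<theta>)) * f i + (\<Sum>t<n. sin (2 * real t * \<theta> + (c * \<theta> - \<theta>))) * f j) / sin \<theta>"
      unfolding sum_distrib_right sum.distrib[symmetric] sum_divide_distrib V_def
    proof (rule sum.cong[OF HOL.refl])
      fix t
      have "real (2 * t + c) * \<theta> = 2 * real t * \<theta> + real c * \<theta>" by (simp add: algebra_simps)
      moreover have "2 * real t * \<theta> + real c * \<theta> - \<theta> = 2 * real t * \<theta> + (real c * \<theta> - \<theta>)" by simp
      ultimately show "(sin (real (2 * t + c) * \<theta>) * f i + sin (real (2 * t + c) * \<theta> - \<theta>) * f j) / sin \<theta> =
         (sin (2 * real t * \<theta> + real c * \<theta>) * f i + sin (2 * real t * \<theta> + (real c * \<theta> - \<theta>)) * f j) / sin \<theta>"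
        by metis
    qed
    then show ?thesis using sum_sin_period[OF s th] by simp
  qed
  note p = play_alt_word[OF assms(1,2) False V, where k = n]
  show ?thesis
  proof
    fix l
    show "play (alt_word (2 * n) i j) f l = f l"
      using p per[of 0] per[of 1] V sum0[of 1] sum0[of 2] by (cases "l = i"; cases "l = j") auto
  qed
qed

lemma play_cong: "u \<sim>\<^sub>C v \<Longrightarrow> play u f = play v f"
proof (induction arbitrary: f rule: word_cong.induct)
  case (base u v)
  then show ?case using play_relation by (auto simp: coxeter_rels_def simp flip: alt_word_even)
qed (auto simp: play_append)

text \<open>With the defining relation, this makes \<open>m i j\<close> the exact order of the
  product of \<open>i\<close> and \<open>j\<close>. If the game returns to its start, then in the
  finite case \<open>2 * k * \<theta>\<close> is a multiple of a full turn, so \<open>n\<close>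
  divides \<open>k\<close>; in the infinite case the fired values grow linearly and cannot
  return.\<close>

lemma order_le:
  assumes ij: "i \<in> I" "j \<in> I" "i \<noteq> j" and "alt_word (2 * k) i j \<sim>\<^sub>C []" "0 < k"
  shows "m i j \<le> enat k"
proof -
  \<comment> \<open>With this start, a return after \<open>2 * k\<close> firings determines both the
    sine and the cosine of \<open>2 * k * \<theta>\<close>.\<close>
  define f :: "'i \<Rightarrow> real" where "f = (\<lambda>l. if l = j then 1 else 0)"
  have pl: "play (alt_word (2 * k) i j) f = f" using play_cong[OF assms(4), of f] by simp
  show ?thesis
  proof (cases "m i j")
    case (enat n)
    define \<theta> where "\<theta> = pi / real n"
    have n: "2 \<le> n" using m_ge2_nat assms enat by blast
    have s: "sin \<theta> \<noteq> 0" using sin_pi_div_nonzero n by (simp add: \<theta>_def)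
    define V where "V = (\<lambda>t::nat. (sin (t * \<theta>) * f i + sin (t * \<theta> - \<theta>) * f j) / sin \<theta>)"
    have V: "V 0 = - f j" "V 1 = f i" "\<And>t. V (t + 2) = coupling i j * V (t + 1) - V t"
      using fired_values_finite[OF enat, where x = "f i" and y = "f j"] s unfolding V_def \<theta>_def by blast+
    have "V (2 * k + 1) = 0" "V (2 * k) = -1"
      using play_alt_word(1,2)[of i j V, OF ij V, where k = k] pl ij by (auto simp: f_def)
    then have 1: "sin (2 * k * \<theta>) = 0" "sin (2 * k * \<theta> - \<theta>) = - sin \<theta>"
      using s ij by (auto simp: V_def f_def field_simps)
    then have "cos (2 * k * \<theta>) = 1" using s by (simp add: sin_diff)
    then obtain l :: int where "2 * k * \<theta> = l * 2 * pi" using cos_one_2pi_int by auto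
    then have "real k = l * real n" using n by (simp add: \<theta>_def field_simps)
    then have "int k = l * int n" by (metis of_int_eq_iff of_int_mult of_int_of_nat_eq)
    then have "int n dvd int k" by simp
    then have "n \<le> k" using assms(5) by (auto intro: dvd_imp_le)
    then show ?thesis using enat by simp
  next
    case infinity
    define V where "V = (\<lambda>t::nat. real t - 1)"
    have V: "V 0 = - f j" "V 1 = f i" "\<And>t. V (t + 2) = coupling i j * V (t + 1) - V t"
      using infinity ij by (auto simp: V_def f_def coupling_def)
    have "V (2 * k) = - 1"
      using play_alt_word(2)[of i j V, OF ij V, where k = k] pl ij by (auto simp: f_def)
    then show ?thesis using assms(5) by (simp add: V_def)
  qed
qed

text \<open>\<open>refl_in u w\<close> says that \<open>w\<close> represents \<open>p a p\<^sup>-\<^sup>1\<close> for an odd number of the factorizations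
  \<open>u = p a q\<close>. This parity depends only on the group elements represented by \<open>u\<close> and \<open>w\<close>; for
  reduced \<open>u\<close> it describes the inversion set.\<close>

primrec refl_in :: "'i list \<Rightarrow> 'i list \<Rightarrow> bool" where
  "refl_in [] w = False"
| "refl_in (a # u) w = (w \<sim>\<^sub>C [a] \<longleftrightarrow> \<not> refl_in u (a # w @ [a]))"

lemma refl_in_cong_right:
  "u \<in> lists I \<Longrightarrow> w \<sim>\<^sub>C w' \<Longrightarrow> refl_in u w = refl_in u w'"
proof (induction u arbitrary: w w')
  case (Cons a u)
  have "a # w @ [a] \<sim>\<^sub>C a # w' @ [a]" using Cons.prems by (intro C_Cons C_right) auto
  with Cons have "refl_in u (a # w @ [a]) = refl_in u (a # w' @ [a])" by auto
  moreover have "w \<sim>\<^sub>C [a] \<longleftrightarrow> w' \<sim>\<^sub>C [a]" using Cons.prems C_sym C_trans by blast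
  ultimately show ?case by simp
qed simp

lemma refl_in_append: "refl_in (u @ v) w = (refl_in u w \<noteq> refl_in v (rev u @ w @ u))"
  by (induction u arbitrary: w) auto

text \<open>The reflections \<open>p a p^-1\<close> coming from the factorizations of an alternating
  word are the alternating words of odd length; conjugation by the first letter shifts the index
  \<open>t\<close> by one, which drives the induction.\<close>

lemma refl_in_alt_word:
  assumes "i \<in> I" "j \<in> I" "w \<in> lists I"
  shows "refl_in (alt_word k i j) w = odd (\<Sum>t<k. of_bool (w \<sim>\<^sub>C alt_word (2 * t + 1) i j) :: nat)"
  using assms
proof (induction k arbitrary: i j w)
  case (Suc k)
  have step: "i # w @ [i] \<sim>\<^sub>C alt_word (2 * t + 1) j i \<longleftrightarrow> w \<sim>\<^sub>C alt_word (2 * Suc t + 1) i j" for t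
  proof -
    have e: "i # alt_word (2 * t + 1) j i @ [i] = alt_word (2 * Suc t + 1) i j"
      using alt_word_snoc[of "2 * t + 2" i j] by simp
    have "i # w @ [i] \<sim>\<^sub>C alt_word (2 * t + 1) j i \<longleftrightarrow> w @ [i] \<sim>\<^sub>C i # alt_word (2 * t + 1) j i"
      by (intro C_Cons_move) (use Suc.prems in auto)
    also have "\<dots> \<longleftrightarrow> (w @ [i]) @ [i] \<sim>\<^sub>C (i # alt_word (2 * t + 1) j i) @ [i]"
      by (intro C_right_iff[symmetric]) (use Suc.prems in auto)
    also have "\<dots> \<longleftrightarrow> w @ [i, i] \<sim>\<^sub>C alt_word (2 * Suc t + 1) i j"
      unfolding e[symmetric] by simp
    also have "\<dots> \<longleftrightarrow> w \<sim>\<^sub>C alt_word (2 * Suc t + 1) i j"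
    proof -
      have "w @ [i, i] \<sim>\<^sub>C w" using C_left[OF C_square, of i w] Suc.prems by simp
      then show ?thesis using C_sym C_trans by blast
    qed
    finally show ?thesis .
  qed
  have "refl_in (alt_word k j i) (i # w @ [i]) =
      odd (\<Sum>t<k. of_bool (w \<sim>\<^sub>C alt_word (2 * Suc t + 1) i j) :: nat)"
    using Suc.IH[of j i "i # w @ [i]"] Suc.prems step by simp
  then show ?case by (simp add: sum.lessThan_Suc_shift del: alt_word.simps(2) sum.lessThan_Suc) auto
qed simp

text \<open>The reflections at positions \<open>t\<close> and \<open>n + t\<close> coincide, because
  the alternating word with \<open>2 * n\<close> letters is trivial; so every reflection is counted
  an even number of times.\<close>

lemma refl_in_relation:
  assumes "i \<in> I" "j \<in> I" "m i j = enat n" "w \<in> lists I"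
  shows "\<not> refl_in (alt_word (2 * n) i j) w"
proof -
  define P where "P = (\<lambda>t. of_bool (w \<sim>\<^sub>C alt_word (2 * t + 1) i j) :: nat)"
  have per: "P (n + t) = P t" for t
  proof -
    have "alt_word (2 * n) i j @ alt_word (2 * t + 1) i j \<sim>\<^sub>C [] @ alt_word (2 * t + 1) i j"
      by (rule C_right[OF C_relation]) (use assms in auto)
    moreover have "alt_word (2 * n) i j @ alt_word (2 * t + 1) i j = alt_word (2 * (n + t) + 1) i j"
      using alt_word_add[of "2 * n" "2 * t + 1" i j] by (simp add: algebra_simps)
    ultimately have "alt_word (2 * (n + t) + 1) i j \<sim>\<^sub>C alt_word (2 * t + 1) i j" by simp
    then have "w \<sim>\<^sub>C alt_word (2 * (n + t) + 1) i j \<longleftrightarrow> w \<sim>\<^sub>C alt_word (2 * t + 1) i j"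
      using C_sym C_trans by blast
    then show ?thesis by (simp add: P_def del: alt_word.simps)
  qed
  have "(\<Sum>t<n + k. P t) = (\<Sum>t<n. P t) + (\<Sum>t<k. P (n + t))" for k
    by (induction k) auto
  from this[of n] have "(\<Sum>t<2 * n. P t) = 2 * (\<Sum>t<n. P t)" by (simp add: per mult_2)
  then show ?thesis using refl_in_alt_word[OF assms(1,2,4)] by (simp add: P_def del: alt_word.simps)
qed

lemma refl_in_cong: "u \<sim>\<^sub>C v \<Longrightarrow> w \<in> lists I \<Longrightarrow> refl_in u w = refl_in v w"
proof (induction arbitrary: w rule: word_cong.induct)
  case (base u v)
  then show ?case using refl_in_relation by (auto simp: coxeter_rels_def simp flip: alt_word_even)
next
  case (append u u' v v')
  have l: "u \<in> lists I" "u' \<in> lists I" "v' \<in> lists I" using C_lists append by auto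
  have "rev u @ w @ u \<sim>\<^sub>C rev u' @ w @ u'"
    by (intro C_append C_rev C_refl append)
  then have "refl_in v' (rev u @ w @ u) = refl_in v' (rev u' @ w @ u')"
    using refl_in_cong_right l by blast
  then show ?case using append l by (simp add: refl_in_append)
qed auto

text \<open>If \<open>w\<close> represents \<open>p c p^-1\<close> where \<open>u = p c q\<close>,
  then multiplying \<open>u\<close> by \<open>w\<close> deletes this occurrence of \<open>c\<close>.
  Odd parity guarantees that such a factorization exists.\<close>

lemma refl_in_deletion:
  assumes "refl_in u w" "u \<in> lists I" "w \<in> lists I"
  obtains p c q where "u = p @ c # q" "w @ u \<sim>\<^sub>C p @ q"
proof -
  have "\<exists>p c q. u = p @ c # q \<and> w @ u \<sim>\<^sub>C p @ q" using assms
  proof (induction u arbitrary: w)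
    case (Cons a u)
    show ?case
    proof (cases "w \<sim>\<^sub>C [a]")
      case True
      have "w @ a # u \<sim>\<^sub>C [a] @ a # u" by (rule C_right) (use True Cons in auto)
      also have "[a] @ a # u \<sim>\<^sub>C u" using C_cancel2[of a u] Cons by auto
      finally show ?thesis by (metis append_Nil)
    next
      case False
      with Cons obtain p c q where pcq: "u = p @ c # q" "(a # w @ [a]) @ u \<sim>\<^sub>C p @ q"
        by (metis Cons_in_lists_iff append_in_lists_conv lists.Nil refl_in.simps(2))
      then have "w @ a # u \<sim>\<^sub>C a # p @ q"
        using C_Cons_move[of a "w @ a # u" "p @ q"] Cons.prems by auto
      then show ?thesis using pcq by (metis append_Cons)
    qed
  qed simp
  then show ?thesis using that by blast
qed

section \<open>Reduced words and the exchange condition\<close>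

definition reduced :: "'i list \<Rightarrow> bool" where
  "reduced u \<longleftrightarrow> u \<in> lists I \<and> (\<forall>v. u \<sim>\<^sub>C v \<longrightarrow> length u \<le> length v)"

lemma reduced_lists: "reduced u \<Longrightarrow> u \<in> lists I"
  by (simp add: reduced_def)

lemma reduced_length_le: "reduced u \<Longrightarrow> u \<sim>\<^sub>C v \<Longrightarrow> length u \<le> length v"
  by (simp add: reduced_def)

lemma reduced_cong: "reduced u \<Longrightarrow> u \<sim>\<^sub>C v \<Longrightarrow> length v \<le> length u \<Longrightarrow> reduced v"
  unfolding reduced_def using C_lists C_trans by (meson order_trans)

lemma reduced_length_eq: "reduced u \<Longrightarrow> reduced v \<Longrightarrow> u \<sim>\<^sub>C v \<Longrightarrow> length u = length v"
  using reduced_length_le C_sym by (meson order_antisym)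

lemma reduced_append:
  assumes "reduced (u @ v)" shows "reduced u" "reduced v"
proof -
  have l: "u \<in> lists I" "v \<in> lists I" using reduced_lists assms by auto
  { fix u' assume "u \<sim>\<^sub>C u'"
    from C_right[OF this l(2)] have "length (u @ v) \<le> length (u' @ v)"
      using reduced_length_le assms by blast }
  moreover { fix v' assume "v \<sim>\<^sub>C v'"
    from C_left[OF this l(1)] have "length (u @ v) \<le> length (u @ v')"
      using reduced_length_le assms by blast }
  ultimately show "reduced u" "reduced v" using l by (auto simp: reduced_def)
qed

lemma reduced_Cons: "reduced (a # u) \<Longrightarrow> reduced u"
  using reduced_append[of "[a]" u] by simp

lemma reduced_rev: "reduced u \<Longrightarrow> reduced (rev u)"
  unfolding reduced_def using C_rev by (metis length_rev rev_in_lists rev_rev_ident)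

text \<open>Let \<open>v\<close> be a shorter word for \<open>a # u\<close>; by parity of lengths it
  is even shorter than \<open>u\<close>. If \<open>[a]\<close> were not an inversion of
  \<open>u\<close>, it would be one of \<open>a # u\<close> and hence of \<open>v\<close>, and
  deleting a letter of \<open>v\<close> would give a word for \<open>u\<close> shorter than
  \<open>u\<close>.\<close>

lemma not_reduced_Cons:
  assumes "reduced u" "a \<in> I" "\<not> reduced (a # u)"
  shows "refl_in u [a]"
proof (rule ccontr)
  assume n: "\<not> refl_in u [a]"
  have l: "u \<in> lists I" using assms reduced_lists by auto
  obtain v where v: "a # u \<sim>\<^sub>C v" "length v < length (a # u)"
    using assms l by (auto simp: reduced_def not_le)
  have "even (length (a # u)) = even (length v)" using C_even_length v by blast
  then have len: "length v < length u" using v by (cases "length v = length u") auto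
  have vl: "v \<in> lists I" using v C_lists by blast
  have "\<not> refl_in u (a # [a] @ [a])"
  proof -
    have "a # [a] @ [a] \<sim>\<^sub>C [a]" using C_cancel2[of a "[a]"] assms by simp
    then show ?thesis using n refl_in_cong_right[OF l] by blast
  qed
  then have "refl_in (a # u) [a]" using C_refl[of "[a]"] assms by simp
  then have "refl_in v [a]" using refl_in_cong[OF v(1), of "[a]"] assms by blast
  then obtain p c q where pq: "v = p @ c # q" "[a] @ v \<sim>\<^sub>C p @ q"
    using refl_in_deletion vl assms by (metis Cons_in_lists_iff lists.Nil)
  have "u \<sim>\<^sub>C a # v" using C_Cons_move v l vl assms by blast
  with pq have "u \<sim>\<^sub>C p @ q" using C_trans by simp
  then show False using pq len reduced_length_le[OF assms(1)] by fastforce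
qed

end

section \<open>Matsumoto's theorem and longest words\<close>

context coxeter
begin

text \<open>Induction on \<open>k\<close>. By symmetry the element has an expression
  \<open>x\<close> starting with \<open>k\<close> letters \<open>b a b ...\<close>, and
  \<open>a # x\<close> is not reduced. The letter removed by the exchange lies beyond this prefix:
  otherwise \<open>a\<close> would equal a reflection of the prefix and the product of
  \<open>a\<close> and \<open>b\<close> would have order at most \<open>k\<close>. Moving
  \<open>a\<close> to the front lengthens the prefix by one.\<close>

lemma alt_prefix:
  assumes "a \<in> I" "b \<in> I" "a \<noteq> b" "reduced (a # u)" "reduced (b # v)" "a # u \<sim>\<^sub>C b # v" "enat k \<le> m a b"
  shows "\<exists>z. alt_word k a b @ z \<sim>\<^sub>C a # u \<and> k + length z = length (a # u)"
  using assms
proof (induction k arbitrary: a b u v)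
  case 0
  then have "alt_word 0 a b @ (a # u) \<sim>\<^sub>C a # u" using C_refl[OF reduced_lists[of "a # u"]] by simp
  then show ?case by (metis add_0)
next
  case (Suc k)
  have l: "a # u \<in> lists I" "b # v \<in> lists I" using Suc.prems reduced_lists by auto
  have "enat k \<le> m b a" using Suc.prems m_sym[of a b] by (metis Suc_ile_eq less_imp_le)
  with Suc.IH[of b a v u] Suc.prems C_sym
  obtain z where z: "alt_word k b a @ z \<sim>\<^sub>C b # v" "k + length z = length (b # v)" by metis
  define x where "x = alt_word k b a @ z"
  have xl: "x \<in> lists I" "z \<in> lists I" using C_lists z by (auto simp: x_def)
  have len: "length (a # u) = length (b # v)" using reduced_length_eq Suc.prems by blast
  have xu: "x \<sim>\<^sub>C a # u" using z Suc.prems C_sym C_trans by (metis x_def)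
  have lx: "length x = length (a # u)" using z len by (simp add: x_def)
  have "reduced x" using reduced_cong[OF Suc.prems(4) C_sym[OF xu]] lx by simp
  moreover have "\<not> reduced (a # x)"
  proof
    assume "reduced (a # x)"
    moreover have "a # x \<sim>\<^sub>C u" using xu C_Cons_move[of a x u] xl l by simp
    ultimately show False using reduced_length_le[of "a # x" u] lx by simp
  qed
  ultimately have "refl_in x [a]" using not_reduced_Cons Suc.prems by blast
  then consider "refl_in (alt_word k b a) [a]" | "refl_in z (rev (alt_word k b a) @ [a] @ alt_word k b a)"
    unfolding x_def refl_in_append by blast
  then show ?case
  proof cases
    case 1
    have "odd (\<Sum>t<k. of_bool ([a] \<sim>\<^sub>C alt_word (2 * t + 1) b a) :: nat)"
      using 1 refl_in_alt_word[of b a "[a]" k] Suc.prems by simp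
    then have "(\<Sum>t<k. of_bool ([a] \<sim>\<^sub>C alt_word (2 * t + 1) b a) :: nat) \<noteq> 0" by (rule odd_pos[THEN less_imp_neq, symmetric])
    then obtain t where t: "t < k" "[a] \<sim>\<^sub>C alt_word (2 * t + 1) b a"
      by (rule sum.not_neutral_contains_not_neutral) (simp del: alt_word.simps)
    have "a # alt_word (2 * t + 1) b a \<sim>\<^sub>C [a, a]"
      using C_sym[OF t(2)] Suc.prems by (intro C_Cons) auto
    also have "[a, a] \<sim>\<^sub>C []" using C_square Suc.prems by blast
    finally have "alt_word (2 * Suc t) a b \<sim>\<^sub>C []" by simp
    then have "m a b \<le> enat (Suc t)" using order_le Suc.prems by blast
    with Suc.prems(7) t(1) have "enat (Suc k) \<le> enat (Suc t)" by (metis order_trans)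
    then show ?thesis using t(1) by simp
  next
    case 2
    define p where "p = alt_word k b a"
    have pl: "p \<in> lists I" using Suc.prems by (simp add: p_def)
    obtain z1 c z2 where del: "z = z1 @ c # z2" "(rev p @ [a] @ p) @ z \<sim>\<^sub>C z1 @ z2"
      using refl_in_deletion[OF 2] xl Suc.prems by (auto simp: p_def)
    have zl: "z1 @ z2 \<in> lists I" using C_lists(2)[OF del(2)] .
    have "p @ rev p @ (a # p @ z) \<sim>\<^sub>C p @ (z1 @ z2)" using C_left[OF del(2) pl] by simp
    moreover have "p @ rev p @ (a # p @ z) \<sim>\<^sub>C a # p @ z"
      by (rule C_cancel_rev) (use pl xl Suc.prems in auto)
    ultimately have "a # p @ z \<sim>\<^sub>C p @ z1 @ z2" using C_sym C_trans by blast
    then have "p @ z \<sim>\<^sub>C a # p @ z1 @ z2"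
      using C_Cons_move[of a "p @ z" "p @ z1 @ z2"] pl zl xl Suc.prems by auto
    then have "a # p @ z1 @ z2 \<sim>\<^sub>C a # u" using xu C_sym C_trans unfolding x_def p_def by blast
    then have "alt_word (Suc k) a b @ (z1 @ z2) \<sim>\<^sub>C a # u" by (simp add: p_def)
    moreover have "Suc k + length (z1 @ z2) = length (a # u)" using del(1) z len by simp
    ultimately show ?thesis by blast
  qed
qed

lemma dihedral_prefix:
  assumes "a \<in> I" "b \<in> I" "a \<noteq> b" "reduced (a # u)" "reduced (b # v)" "a # u \<sim>\<^sub>C b # v"
  obtains n z where "m a b = enat n" "2 \<le> n" "alt_word n a b @ z \<sim>\<^sub>C a # u" "reduced (alt_word n a b @ z)"
proof -
  have "\<exists>n. m a b = enat n"
  proof (rule ccontr)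
    assume "\<nexists>n. m a b = enat n"
    then have "m a b = \<infinity>" by auto
    \<comment> \<open>An infinite entry would allow an alternating prefix longer than the word
      itself.\<close>
    then show False using alt_prefix[OF assms, of "Suc (length (a # u))"] by auto
  qed
  then obtain n where n: "m a b = enat n" by blast
  moreover have "2 \<le> n" using n m_ge2_nat assms by blast
  moreover obtain z where z: "alt_word n a b @ z \<sim>\<^sub>C a # u" "n + length z = length (a # u)"
    using alt_prefix[OF assms, of n] n by auto
  moreover have "reduced (alt_word n a b @ z)"
    by (rule reduced_cong[OF assms(4) C_sym]) (use z in auto)
  ultimately show ?thesis using that by blast
qed

text \<open>Words with the same first letter are handled by induction on their tails. If the first
  letters differ, the two sides of the braid relation, followed by a common \<open>z\<close>, are
  inserted between \<open>u\<close> and \<open>v\<close>; each comparison is then between words with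
  the same first letter.\<close>

lemma matsumoto: "reduced u \<Longrightarrow> reduced v \<Longrightarrow> u \<sim>\<^sub>C v \<Longrightarrow> u \<sim>\<^sub>A v"
proof (induction "length u" arbitrary: u v rule: less_induct)
  case less
  have len: "length u = length v" using less reduced_length_eq by blast
  have tails: "x # s \<sim>\<^sub>A x # t" if "reduced (x # s)" "reduced (x # t)" "x # s \<sim>\<^sub>C x # t"
    "length (x # s) = length u" for x s t
  proof -
    have l: "x \<in> I" "s \<in> lists I" "t \<in> lists I" using that(1,2) reduced_lists by auto
    then have "s \<sim>\<^sub>C t" using C_Cons_iff that by blast
    then have "s \<sim>\<^sub>A t" using less.hyps[of s t] that reduced_Cons[OF that(1)] reduced_Cons[OF that(2)] by auto
    then show ?thesis using A_Cons l by blast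
  qed
  show ?case
  proof (cases u)
    case Nil
    then show ?thesis using len by (auto intro: A_refl)
  next
    case (Cons a u')
    then obtain b v' where v: "v = b # v'" using len by (cases v) auto
    have ab: "a \<in> I" "b \<in> I" using Cons v less.prems reduced_lists by auto
    show ?thesis
    proof (cases "a = b")
      case True
      then show ?thesis using tails less.prems Cons v by blast
    next
      case False
      obtain n z where n: "m a b = enat n" "2 \<le> n" "alt_word n a b @ z \<sim>\<^sub>C a # u'" "reduced (alt_word n a b @ z)"
        using dihedral_prefix[OF ab False] less.prems Cons v by blast
      have zl: "z \<in> lists I" using C_lists n by auto
      have sw: "alt_word n a b @ z \<sim>\<^sub>A alt_word n b a @ z"
        using A_right[OF A_alt[OF ab False n(1)] zl] .
      have len2: "length (alt_word n a b @ z) = length u" "length (alt_word n b a @ z) = length u"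
        using reduced_length_eq[OF n(4) less.prems(1)] n Cons by auto
      have red2: "reduced (alt_word n b a @ z)"
        using reduced_cong[OF n(4) A_imp_C[OF sw]] len2 by simp
      have "a # u' \<sim>\<^sub>A alt_word n a b @ z"
        using tails[of a u' "alt_word (n - 1) b a @ z"] n C_sym less.prems Cons len2 by (auto simp: alt_word_Cons)
      also note sw
      also have "alt_word n b a @ z \<sim>\<^sub>A b # v'"
      proof -
        have "alt_word n b a @ z \<sim>\<^sub>C b # v'"
          using A_imp_C[OF sw] n(3) less.prems(3) Cons v C_sym C_trans by blast
        then show ?thesis
          using tails[of b "alt_word (n - 1) a b @ z" v'] n red2 less.prems v len2 by (auto simp: alt_word_Cons)
      qed
      finally show ?thesis using Cons v by simp
    qed
  qed
qed

section \<open>Left divisibility in the Artin monoid, descents and subwords\<close>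

definition ldvd (infix "\<preceq>" 50) where "u \<preceq> v \<longleftrightarrow> (\<exists>z. u @ z \<sim>\<^sub>A v)"

lemma ldvdI: "u @ z \<sim>\<^sub>A v \<Longrightarrow> u \<preceq> v"
  by (auto simp: ldvd_def)

lemma ldvdE:
  assumes "u \<preceq> v" obtains z where "u @ z \<sim>\<^sub>A v" "z \<in> lists I" "u \<in> lists I" "v \<in> lists I"
  using assms A_lists unfolding ldvd_def by (metis append_in_lists_conv)

lemma ldvd_refl: "u \<in> lists I \<Longrightarrow> u \<preceq> u"
  by (rule ldvdI[of _ "[]"]) (simp add: A_refl)

lemma Nil_ldvd: "u \<in> lists I \<Longrightarrow> [] \<preceq> u"
  by (rule ldvdI[of _ u]) (simp add: A_refl)

lemma ldvd_trans [trans]: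
  assumes "u \<preceq> v" "v \<preceq> w" shows "u \<preceq> w"
proof -
  obtain x where x: "u @ x \<sim>\<^sub>A v" using assms ldvdE by blast
  obtain y where y: "v @ y \<sim>\<^sub>A w" "y \<in> lists I" using assms ldvdE by blast
  have "u @ x @ y \<sim>\<^sub>A w" using A_trans[OF A_right[OF x y(2)] y(1)] by simp
  then show ?thesis by (rule ldvdI)
qed

lemma ldvd_cong_right: "u \<preceq> v \<Longrightarrow> v \<sim>\<^sub>A w \<Longrightarrow> u \<preceq> w"
  unfolding ldvd_def using A_trans by blast

lemma ldvd_cong_left: "u \<preceq> v \<Longrightarrow> u \<sim>\<^sub>A u' \<Longrightarrow> u' \<preceq> v"
  using ldvd_trans[of u' u v] ldvdI[of u' "[]" u] A_sym by simp

lemma ldvd_append: "u \<preceq> v \<Longrightarrow> z \<in> lists I \<Longrightarrow> u \<preceq> v @ z"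
  using ldvd_trans[of u v "v @ z"] ldvdI[of v z "v @ z"] A_refl ldvdE by (metis append_in_lists_conv)

lemma ldvd_left: "u \<preceq> v \<Longrightarrow> p \<in> lists I \<Longrightarrow> p @ u \<preceq> p @ v"
  unfolding ldvd_def using A_left by fastforce

lemma ldvd_Cons: "u \<preceq> v \<Longrightarrow> a \<in> I \<Longrightarrow> a # u \<preceq> a # v"
  using ldvd_left[of u v "[a]"] by simp

lemma ldvd_reduced:
  assumes "u \<preceq> v" "reduced v" shows "reduced u"
proof -
  obtain z where z: "u @ z \<sim>\<^sub>A v" using assms ldvdE by blast
  then have "reduced (u @ z)" using reduced_cong[OF assms(2) C_sym[OF A_imp_C[OF z]]] A_length[OF z] by simp
  then show ?thesis using reduced_append by blast
qed

lemma ldvd_length: "u \<preceq> v \<Longrightarrow> length u \<le> length v"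
  unfolding ldvd_def using A_length by fastforce

lemma ldvd_length_eq: "u \<preceq> v \<Longrightarrow> length v \<le> length u \<Longrightarrow> u \<sim>\<^sub>A v"
  unfolding ldvd_def
proof clarify
  fix z assume "u @ z \<sim>\<^sub>A v" "length v \<le> length u"
  moreover from this have "z = []" using A_length[of "u @ z" v] by (cases z) auto
  ultimately show "u \<sim>\<^sub>A v" by simp
qed

lemma letter_ldvd: "a # u \<sim>\<^sub>A v \<Longrightarrow> [a] \<preceq> v"
  by (rule ldvdI[of _ u]) simp

text \<open>The exchange condition gives a word of the same length starting with \<open>a\<close>
  for the same group element; Matsumoto's theorem lifts this equality to the monoid.\<close>

lemma descent:
  assumes "reduced u" "a \<in> I" "\<not> reduced (a # u)"
  shows "[a] \<preceq> u"
proof -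
  have l: "u \<in> lists I" using reduced_lists assms by blast
  obtain p c q where d: "u = p @ c # q" "[a] @ u \<sim>\<^sub>C p @ q"
    using refl_in_deletion[OF not_reduced_Cons[OF assms]] assms l by auto
  have "u \<sim>\<^sub>C a # p @ q" using C_Cons_move[of a u "p @ q"] d assms l C_lists[OF d(2)] by simp
  moreover from this have "reduced (a # p @ q)" using reduced_cong[OF assms(1)] d by simp
  ultimately have "u \<sim>\<^sub>A a # p @ q" using matsumoto assms by blast
  then show ?thesis using A_sym letter_ldvd by blast
qed

lemma descent_iff:
  assumes "reduced u" "a \<in> I"
  shows "[a] \<preceq> u \<longleftrightarrow> \<not> reduced (a # u)"
proof
  assume "[a] \<preceq> u"
  then obtain z where z: "a # z \<sim>\<^sub>A u" "z \<in> lists I" using ldvdE by (metis append_Cons append_Nil)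
  then have "a # u \<sim>\<^sub>C z" using C_Cons_move A_imp_C C_sym C_lists assms(2) by meson
  then show "\<not> reduced (a # u)" using reduced_length_le[of "a # u" z] A_length[OF z(1)] by auto
qed (use descent assms in blast)

text \<open>The expression is built letter by letter. If \<open>a # v\<close> is not reduced, then
  \<open>v\<close> equals some \<open>a # z\<close> already in the monoid, where the set of letters
  is preserved, so \<open>z\<close> stays over \<open>J\<close>.\<close>

lemma ex_reduced_parabolic:
  assumes "u \<in> lists J" "J \<subseteq> I"
  shows "\<exists>v. reduced v \<and> v \<in> lists J \<and> u \<sim>\<^sub>C v"
  using assms(1)
proof (induction u)
  case Nil
  have "reduced []" by (simp add: reduced_def)
  then show ?case using C_refl by auto
next
  case (Cons a u)
  then obtain v where v: "reduced v" "v \<in> lists J" "u \<sim>\<^sub>C v" by auto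
  have a: "a \<in> I" "a \<in> J" using Cons assms by auto
  have av: "a # u \<sim>\<^sub>C a # v" using C_Cons v a by blast
  show ?case
  proof (cases "reduced (a # v)")
    case True
    then show ?thesis using av v a by auto
  next
    case False
    then obtain z where z: "a # z \<sim>\<^sub>A v" using descent v a ldvdE by (metis append_Cons append_Nil)
    then have zl: "z \<in> lists J" using v(2) A_set by (force simp: in_lists_conv_set)
    have "reduced (a # z)" using reduced_cong[OF v(1) C_sym[OF A_imp_C[OF z]]] A_length[OF z] by simp
    then have "reduced z" using reduced_Cons by blast
    moreover have "a # v \<sim>\<^sub>C z" using C_Cons_move[of a z v] A_imp_C[OF z] a zl v assms reduced_lists C_sym
      by (metis C_lists(1) Cons_in_lists_iff)
    ultimately show ?thesis using zl av C_trans by blast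
  qed
qed

text \<open>After cancellation of squares a subword is again alternating. The bound is strict when
  it starts with \<open>b\<close>, since the initial \<open>a\<close> was then skipped or
  cancelled.\<close>

lemma subseq_alt_word:
  assumes "a \<in> I" "b \<in> I" "subseq x (alt_word n a b)"
  shows "\<exists>k. (k \<le> n \<and> x \<sim>\<^sub>C alt_word k a b) \<or> (k < n \<and> x \<sim>\<^sub>C alt_word k b a)"
  using assms
proof (induction n arbitrary: a b x)
  case 0
  then have "x = []" by (auto elim: list_emb.cases)
  then show ?case using C_refl[of "[]"] by simp
next
  case (Suc n)
  show ?case
  proof (cases "subseq x (alt_word n b a)")
    case True
    then show ?thesis using Suc.IH[of b a x] Suc.prems by (metis le_SucI less_Suc_eq_le less_imp_le)
  next
    case False
    with Suc.prems obtain y where y: "x = a # y" "subseq y (alt_word n b a)"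
      by (auto elim: list_emb.cases)
    from Suc.IH[of b a y] y Suc.prems obtain k
      where k: "(k \<le> n \<and> y \<sim>\<^sub>C alt_word k b a) \<or> (k < n \<and> y \<sim>\<^sub>C alt_word k a b)" by blast
    show ?thesis
    proof (cases "y \<sim>\<^sub>C alt_word k b a")
      case True
      then have "x \<sim>\<^sub>C alt_word (Suc k) a b" using y C_Cons Suc.prems by simp
      then show ?thesis using k by (metis Suc_le_mono less_imp_le)
    next
      case False
      then have k: "k < n" "y \<sim>\<^sub>C alt_word k a b" using k by auto
      show ?thesis
      proof (cases k)
        case 0
        then have "x \<sim>\<^sub>C alt_word 1 a b" using y k C_Cons Suc.prems by simp
        then show ?thesis using k by (metis One_nat_def Suc_le_mono le0)
      next
        case (Suc k')
        then have "x \<sim>\<^sub>C a # a # alt_word k' b a" using y k C_Cons Suc.prems by simp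
        also have "a # a # alt_word k' b a \<sim>\<^sub>C alt_word k' b a" using C_cancel2 Suc.prems by simp
        finally show ?thesis using k Suc by (intro exI[of _ k']) auto
      qed
    qed
  qed
qed

text \<open>An alternating word with fewer than \<open>n\<close> letters is a subword of both sides
  of the braid relation, whichever letter it starts with; only the full word requires the relation
  itself.\<close>

lemma subseq_alt_word_swap:
  assumes "a \<in> I" "b \<in> I" "m a b = enat n" "subseq x (alt_word n a b)"
  shows "\<exists>y. subseq y (alt_word n b a) \<and> x \<sim>\<^sub>C y"
proof -
  have pre: "subseq (alt_word k i j) (alt_word l i j)" if "k \<le> l" for k l and i j :: 'i
    using alt_word_add[of k "l - k" i j] that by (metis le_add_diff_inverse prefixI prefix_imp_subseq)
  obtain k where k: "(k \<le> n \<and> x \<sim>\<^sub>C alt_word k a b) \<or> (k < n \<and> x \<sim>\<^sub>C alt_word k b a)"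
    using subseq_alt_word assms by blast
  then consider "k < n" "x \<sim>\<^sub>C alt_word k b a" | "k < n" "x \<sim>\<^sub>C alt_word k a b" | "k = n" "x \<sim>\<^sub>C alt_word k a b"
    by fastforce
  then show ?thesis
  proof cases
    case 1
    then show ?thesis using pre[of k n b a] by auto
  next
    case 2
    then have "subseq (alt_word k a b) (alt_word (n - 1) a b)"
      using pre[of k "n - 1" a b] by auto
    then have "subseq (alt_word k a b) (alt_word (Suc (n - 1)) b a)" by auto
    moreover have "Suc (n - 1) = n" using 2 by simp
    ultimately show ?thesis using 2 by metis
  next
    case 3
    then have "x \<sim>\<^sub>C alt_word n b a" using C_alt_swap[of a b n] assms C_trans by blast
    then show ?thesis using pre[of n n b a] by auto
  qed
qed

text \<open>Both directions are carried through the induction so that the symmetry case is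
  immediate.\<close>

lemma subseq_A:
  "u \<sim>\<^sub>A v \<Longrightarrow> (\<forall>x. subseq x u \<longrightarrow> (\<exists>y. subseq y v \<and> x \<sim>\<^sub>C y)) \<and> (\<forall>y. subseq y v \<longrightarrow> (\<exists>x. subseq x u \<and> y \<sim>\<^sub>C x))"
proof (induction rule: word_cong.induct)
  case (base u v)
  then show ?case using subseq_alt_word_swap m_sym by (auto simp: artin_rels_def)
next
  case (refl u)
  have "subseq x u \<Longrightarrow> x \<sim>\<^sub>C x" for x
    using refl by (intro C_refl) (auto simp: in_lists_conv_set elim!: list_emb_set)
  then show ?case by blast
next
  case (trans u v w)
  from trans.IH show ?case using C_trans by meson
next
  case (append u u' v v')
  have w: "\<exists>y. subseq y (p' @ q') \<and> x \<sim>\<^sub>C y"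
    if h: "\<forall>x. subseq x p \<longrightarrow> (\<exists>y. subseq y p' \<and> x \<sim>\<^sub>C y)" "\<forall>x. subseq x q \<longrightarrow> (\<exists>y. subseq y q' \<and> x \<sim>\<^sub>C y)"
      "subseq x (p @ q)" for p q p' q' x
  proof -
    obtain x1 x2 where x: "x = x1 @ x2" "subseq x1 p" "subseq x2 q" using h(3) subseq_appendE by blast
    with h obtain y1 y2 where "subseq y1 p'" "x1 \<sim>\<^sub>C y1" "subseq y2 q'" "x2 \<sim>\<^sub>C y2" by blast
    then show ?thesis using x(1) C_append[of x1 y1 x2 y2] list_emb_append_mono[of "(=)" y1 p' y2 q'] by blast
  qed
  show ?case
  proof (intro conjI allI impI)
    fix x assume "subseq x (u @ v)"
    then show "\<exists>y. subseq y (u' @ v') \<and> x \<sim>\<^sub>C y"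
      using w[OF conjunct1[OF append.IH(1)] conjunct1[OF append.IH(2)]] by blast
  next
    fix x assume "subseq x (u' @ v')"
    then show "\<exists>y. subseq y (u @ v) \<and> x \<sim>\<^sub>C y"
      using w[OF conjunct2[OF append.IH(1)] conjunct2[OF append.IH(2)]] by blast
  qed
next
  case (sym u v)
  from sym.IH show ?case by blast
qed

text \<open>The elements of \<open>W\<close> represented by subwords of \<open>t\<close> do not depend on the reduced word \<open>t\<close>, and
  they are closed under left multiplication by the descents of \<open>t\<close>.\<close>

lemma descents_subseq:
  assumes "J \<subseteq> I" "t \<in> lists I" "\<And>a. a \<in> J \<Longrightarrow> [a] \<preceq> t" "u \<in> lists J"
  shows "\<exists>x. subseq x t \<and> u \<sim>\<^sub>C x"
  using assms(4)
proof (induction u)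
  case Nil
  then show ?case using C_refl by (intro exI[of _ "[]"]) auto
next
  case (Cons a u)
  then obtain x where x: "subseq x t" "u \<sim>\<^sub>C x" by auto
  have a: "a \<in> I" "[a] \<preceq> t" using Cons assms by auto
  obtain t' where t': "a # t' \<sim>\<^sub>A t" using a ldvdE by (metis append_Cons append_Nil)
  obtain y where y: "subseq y (a # t')" "x \<sim>\<^sub>C y" using subseq_A[OF t'] x by blast
  have uy: "u \<sim>\<^sub>C y" using x y C_trans by blast
  have "\<exists>w. subseq w (a # t') \<and> a # u \<sim>\<^sub>C w"
  proof (cases "subseq y t'")
    case True
    then show ?thesis using C_Cons[OF uy a(1)] by auto
  next
    case False
    then obtain y' where y': "y = a # y'" "subseq y' t'" using y by (auto elim: list_emb.cases)
    then have "a # u \<sim>\<^sub>C a # a # y'" using C_Cons[OF uy a(1)] by simp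
    also have "a # a # y' \<sim>\<^sub>C y'" using C_cancel2 a y' C_lists[OF uy] by auto
    finally show ?thesis using y' by auto
  qed
  then show ?case using subseq_A[OF t'] C_trans by meson
qed

text \<open>This is how longest words are recognized: divisibility by all letters of
  \<open>J\<close> already forces the length to be at least the maximum over
  \<open>J\<close>.\<close>

lemma descents_length:
  assumes "J \<subseteq> I" "t \<in> lists I" "\<And>a. a \<in> J \<Longrightarrow> [a] \<preceq> t" "u \<in> lists J" "reduced u"
  shows "length u \<le> length t"
proof -
  obtain x where x: "subseq x t" "u \<sim>\<^sub>C x" using descents_subseq[of J t u] assms by blast
  then show ?thesis using reduced_length_le[OF assms(5) x(2)] list_emb_length[OF x(1)] by simp
qed

section \<open>Longest words of parabolic subgroups\<close>

definition longest :: "'i set \<Rightarrow> 'i list \<Rightarrow> bool" where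
  "longest J z \<longleftrightarrow> reduced z \<and> z \<in> lists J \<and> (\<forall>u. reduced u \<longrightarrow> u \<in> lists J \<longrightarrow> length u \<le> length z)"

lemma longest_reduced: "longest J z \<Longrightarrow> reduced z"
  and longest_lists: "longest J z \<Longrightarrow> z \<in> lists J"
  by (auto simp: longest_def)

lemma longest_rev: "longest J z \<Longrightarrow> longest J (rev z)"
  by (simp add: longest_def reduced_rev)

lemma longest_descent:
  assumes "longest J z" "J \<subseteq> I" "a \<in> J" shows "[a] \<preceq> z"
proof -
  have "\<not> reduced (a # z)" using assms by (auto simp: longest_def)
  then show ?thesis using descent assms longest_reduced by blast
qed

text \<open>Write \<open>z = v b\<close>. Since \<open>v\<close> is too short to be divisible by all
  letters of \<open>J\<close>, some \<open>a # v\<close> is reduced, whereas \<open>a\<close>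
  divides \<open>v b\<close>. The letter removed by the exchange is therefore the final
  \<open>b\<close>, which gives \<open>a v = v b\<close>.\<close>

lemma longest_swap_letter:
  assumes "longest J z" "J \<subseteq> I" "b \<in> J"
  shows "\<exists>a\<in>J. a # z \<sim>\<^sub>A z @ [b]"
proof -
  have "[b] \<preceq> rev z" using longest_descent longest_rev assms by blast
  then obtain v' where v': "b # v' \<sim>\<^sub>A rev z" using ldvdE by (metis append_Cons append_Nil)
  define v where "v = rev v'"
  have zv: "v @ [b] \<sim>\<^sub>A z" using A_rev[OF v'] by (simp add: v_def)
  have len: "length z = Suc (length v)" using A_length[OF zv] by simp
  have redvb: "reduced (v @ [b])"
    using reduced_cong[OF longest_reduced[OF assms(1)] C_sym[OF A_imp_C[OF zv]]] len by simp
  then have redv: "reduced v" using reduced_append by blast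
  have vl: "v \<in> lists I" using redv reduced_lists by blast
  have "\<exists>a\<in>J. \<not> [a] \<preceq> v"
    using descents_length[OF assms(2) vl _ longest_lists[OF assms(1)] longest_reduced[OF assms(1)]] len by force
  then obtain a where a: "a \<in> J" "\<not> [a] \<preceq> v" by blast
  then have aI: "a \<in> I" using assms by blast
  have redav: "reduced (a # v)" using a aI redv descent by blast
  have "[a] \<preceq> v @ [b]" using longest_descent[OF assms(1,2) a(1)] zv A_sym ldvd_cong_right by blast
  then have "refl_in (v @ [b]) [a]" using descent_iff[OF redvb aI] not_reduced_Cons[OF redvb aI] by blast
  moreover have "\<not> refl_in v [a]"
  proof
    assume "refl_in v [a]"
    then obtain p c q where "v = p @ c # q" "[a] @ v \<sim>\<^sub>C p @ q"
      using refl_in_deletion vl aI by (metis Cons_in_lists_iff lists.Nil)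
    then show False using reduced_length_le[OF redav] by fastforce
  qed
  ultimately have "rev v @ [a] @ v \<sim>\<^sub>C [b]" unfolding refl_in_append by auto
  from C_left[OF this vl] have "v @ rev v @ ([a] @ v) \<sim>\<^sub>C v @ [b]" by simp
  moreover have "v @ rev v @ ([a] @ v) \<sim>\<^sub>C [a] @ v" by (rule C_cancel_rev) (use vl aI in auto)
  ultimately have "a # v \<sim>\<^sub>C v @ [b]" using C_sym C_trans by (metis append_Cons append_Nil)
  then have av: "a # v \<sim>\<^sub>A v @ [b]" using matsumoto redav redvb by blast
  have bI: "b \<in> I" using assms by blast
  have "a # z \<sim>\<^sub>A a # v @ [b]" using A_Cons[OF A_sym[OF zv] aI] .
  also have "a # v @ [b] \<sim>\<^sub>A (v @ [b]) @ [b]" using A_right[OF av, of "[b]"] bI by simp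
  also have "(v @ [b]) @ [b] \<sim>\<^sub>A z @ [b]" using A_right[OF zv, of "[b]"] bI by simp
  finally show ?thesis using a(1) by blast
qed

end

section \<open>Cancellation and least common multiples\<close>

context coxeter
begin

text \<open>Expresses that an equation \<open>a x = b y\<close> is a multiple of the braid relation
  between \<open>a\<close> and \<open>b\<close>; the exponent \<open>n - 1\<close> is due to the
  stripped first letters. The case \<open>a = b\<close> is left cancellation.\<close>

definition common :: "'i \<Rightarrow> 'i list \<Rightarrow> 'i \<Rightarrow> 'i list \<Rightarrow> bool" where
  "common a x b y \<longleftrightarrow> (a = b \<and> x \<sim>\<^sub>A y) \<or> (a \<noteq> b \<and> (\<exists>n z. m a b = enat n \<and>
    x \<sim>\<^sub>A alt_word (n - 1) b a @ z \<and> y \<sim>\<^sub>A alt_word (n - 1) a b @ z))"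

definition common_upto :: "nat \<Rightarrow> bool" where
  "common_upto l \<longleftrightarrow> (\<forall>a x b y. a # x \<sim>\<^sub>A b # y \<longrightarrow> length x < l \<longrightarrow> common a x b y)"

lemma common_cong: "common a x b y \<Longrightarrow> x \<sim>\<^sub>A x' \<Longrightarrow> y \<sim>\<^sub>A y' \<Longrightarrow> common a x' b y'"
  unfolding common_def using A_sym A_trans by meson

lemma common_sym: "a \<in> I \<Longrightarrow> b \<in> I \<Longrightarrow> common a x b y \<Longrightarrow> common b y a x"
  unfolding common_def using A_sym m_sym by metis

lemma cancel_upto:
  assumes "common_upto l" "p @ x \<sim>\<^sub>A p @ y" "length (p @ x) \<le> l"
  shows "x \<sim>\<^sub>A y"
  using assms(2,3)
proof (induction p)
  case (Cons a p)
  then have "common a (p @ x) a (p @ y)" using assms(1) unfolding common_upto_def by auto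
  then show ?case using Cons by (auto simp: common_def)
qed simp

text \<open>Available before cancellation is known in the monoid: for reduced words one cancels in
  the group and returns by Matsumoto's theorem.\<close>

lemma cancel_reduced:
  assumes "p @ x \<sim>\<^sub>A p @ y" "reduced (p @ x)" shows "x \<sim>\<^sub>A y"
proof -
  have "reduced (p @ y)" using reduced_cong[OF assms(2) A_imp_C[OF assms(1)]] A_length[OF assms(1)] by simp
  then have r: "reduced x" "reduced y" using assms reduced_append by blast+
  have "p @ x \<sim>\<^sub>C p @ y" using A_imp_C assms by blast
  then have "x \<sim>\<^sub>C y" using C_left_iff[of p x y] A_lists[OF assms(1)] by simp
  then show ?thesis using matsumoto r by blast
qed

lemma ldvd_cancel_upto:
  assumes "common_upto l" "p @ u \<preceq> p @ y" "length (p @ y) \<le> l" shows "u \<preceq> y"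
proof -
  obtain x where x: "p @ u @ x \<sim>\<^sub>A p @ y" using assms ldvdE by (metis append.assoc)
  then have "u @ x \<sim>\<^sub>A y" using cancel_upto[OF assms(1) x] assms(3) A_length[OF x] by simp
  then show ?thesis by (rule ldvdI)
qed

lemma ldvd_cancel_reduced:
  assumes "p @ u \<preceq> p @ y" "reduced (p @ y)" shows "u \<preceq> y"
proof -
  obtain x where x: "p @ u @ x \<sim>\<^sub>A p @ y" using assms ldvdE by (metis append.assoc)
  then have "y \<sim>\<^sub>A u @ x" using cancel_reduced[OF A_sym[OF x]] assms by simp
  then show ?thesis using A_sym ldvdI by blast
qed

lemma reduced_A: "reduced u \<Longrightarrow> u \<sim>\<^sub>A v \<Longrightarrow> reduced v"
  using reduced_cong A_imp_C A_length by (metis order_refl)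

lemma ldvd_ConsE:
  assumes "a # u \<preceq> y" obtains y' where "a # y' \<sim>\<^sub>A y" "a \<in> I" "y' \<in> lists I" "u \<preceq> y'"
proof -
  obtain x where x: "a # u @ x \<sim>\<^sub>A y" using assms ldvdE by (metis append_Cons)
  have "u @ x \<in> lists I" "a \<in> I" using A_lists[OF x] by auto
  then show ?thesis using that[OF x] ldvdI[OF A_refl] by blast
qed

text \<open>The counterpart of \<open>dihedral_ldvd_upto\<close> below reduced words, obtained from
  the group through \<open>dihedral_prefix\<close> and Matsumoto's theorem.\<close>

lemma reduced_dihedral_ldvd:
  assumes "reduced z" "[a] \<preceq> z" "[b] \<preceq> z" "a \<noteq> b"
  obtains n where "m a b = enat n" "2 \<le> n" "alt_word n a b \<preceq> z" "alt_word n b a \<preceq> z"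
proof -
  obtain x where x: "a # x \<sim>\<^sub>A z" "a \<in> I" using assms ldvd_ConsE by metis
  obtain y where y: "b # y \<sim>\<^sub>A z" "b \<in> I" using assms ldvd_ConsE by metis
  have r: "reduced (a # x)" "reduced (b # y)" using x y reduced_A A_sym assms by blast+
  have xy: "a # x \<sim>\<^sub>C b # y" using x y A_imp_C A_sym A_trans by blast
  obtain n t where n: "m a b = enat n" "2 \<le> n" "alt_word n a b @ t \<sim>\<^sub>C a # x" "reduced (alt_word n a b @ t)"
    using dihedral_prefix[OF x(2) y(2) assms(4) r xy] .
  have t: "t \<in> lists I" using n reduced_lists by auto
  have e: "alt_word n a b @ t \<sim>\<^sub>A z" using matsumoto[OF n(4) r(1) n(3)] x A_trans by blast
  have "alt_word n b a @ t \<sim>\<^sub>A alt_word n a b @ t"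
    using A_sym[OF A_right[OF A_alt[OF x(2) y(2) assms(4) n(1)] t]] .
  then have "alt_word n b a @ t \<sim>\<^sub>A z" using e A_trans by blast
  then show ?thesis using that n e ldvdI by blast
qed

lemma dihedral_ldvd_upto:
  assumes "common_upto l" "length y \<le> l" "[a] \<preceq> y" "[b] \<preceq> y" "a \<noteq> b"
  obtains n where "m a b = enat n" "alt_word n a b \<preceq> y" "alt_word n b a \<preceq> y"
proof -
  obtain x where x: "a # x \<sim>\<^sub>A y" "a \<in> I" using assms ldvd_ConsE by metis
  obtain x' where x': "b # x' \<sim>\<^sub>A y" "b \<in> I" using assms ldvd_ConsE by metis
  have "common a x b x'"
    using assms(1,2) A_length[OF x(1)] A_trans[OF x(1) A_sym[OF x'(1)]] unfolding common_upto_def by auto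
  then obtain n z where n: "m a b = enat n" "x \<sim>\<^sub>A alt_word (n - 1) b a @ z" using assms by (auto simp: common_def)
  have zl: "z \<in> lists I" using A_lists n by auto
  have n2: "2 \<le> n" using m_ge2_nat n x x' assms by blast
  have "alt_word n a b @ z \<sim>\<^sub>A a # x" using A_Cons[OF A_sym[OF n(2)] x(2)] n2 by (simp add: alt_word_Cons)
  then have e: "alt_word n a b @ z \<sim>\<^sub>A y" using x A_trans by blast
  have "alt_word n b a @ z \<sim>\<^sub>A alt_word n a b @ z"
    using A_sym[OF A_right[OF A_alt[OF x(2) x'(2) assms(5) n(1)] zl]] .
  then have "alt_word n b a @ z \<sim>\<^sub>A y" using e A_trans by blast
  then show ?thesis using that n e ldvdI by blast
qed

text \<open>Two divisors of \<open>y\<close> that also divide a reduced word \<open>z\<close> have a common multiple dividing both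
  \<open>y\<close> and \<open>z\<close>. Divisors \<open>a \<dots>\<close> and \<open>b \<dots>\<close> with \<open>a \<noteq> b\<close> are joined through the least common
  multiple of \<open>a\<close> and \<open>b\<close>, so that only divisors with the same first letter need the induction.\<close>

lemma join_upto:
  assumes "common_upto l" "length y \<le> l" "reduced z" "u \<preceq> z" "v \<preceq> z" "u \<preceq> y" "v \<preceq> y"
  shows "\<exists>t. t \<preceq> z \<and> t \<preceq> y \<and> u \<preceq> t \<and> v \<preceq> t"
  using assms(2-)
proof (induction "length y" arbitrary: y z u v rule: less_induct)
  case less
  have same: "\<exists>t. t \<preceq> z \<and> t \<preceq> y \<and> a # p \<preceq> t \<and> a # q \<preceq> t"
    if h: "a # p \<preceq> z" "a # p \<preceq> y" "a # q \<preceq> z" "a # q \<preceq> y" for a p q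
  proof -
    obtain y1 where y1: "a # y1 \<sim>\<^sub>A y" "a \<in> I" "y1 \<in> lists I" "p \<preceq> y1" using h(2) ldvd_ConsE by metis
    obtain z1 where z1: "a # z1 \<sim>\<^sub>A z" "z1 \<in> lists I" "p \<preceq> z1" using h(1) ldvd_ConsE by metis
    have rz: "reduced (a # z1)" using z1 less.prems reduced_A A_sym by blast
    have ly: "length y = Suc (length y1)" using A_length[OF y1(1)] by simp
    have "a # q \<preceq> a # z1" "a # q \<preceq> a # y1" using h y1 z1 A_sym ldvd_cong_right by blast+
    then have "q \<preceq> z1" "q \<preceq> y1"
      using ldvd_cancel_reduced[of "[a]" q z1] ldvd_cancel_upto[OF assms(1), of "[a]" q y1] rz less.prems ly by auto
    then obtain t where t: "t \<preceq> z1" "t \<preceq> y1" "p \<preceq> t" "q \<preceq> t"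
      using less.hyps[of y1 z1 p q] y1 z1 reduced_Cons[OF rz] less.prems ly by auto
    then have "a # t \<preceq> z" "a # t \<preceq> y" using ldvd_Cons y1 z1 ldvd_cong_right by blast+
    then show ?thesis using t ldvd_Cons y1(2) by blast
  qed
  show ?case
  proof (cases u)
    case Nil
    then show ?thesis using less.prems ldvd_refl Nil_ldvd ldvdE by metis
  next
    case u: (Cons a u')
    show ?thesis
    proof (cases v)
      case Nil
      then show ?thesis using less.prems ldvd_refl Nil_ldvd ldvdE by metis
    next
      case v: (Cons b v')
      show ?thesis
      proof (cases "a = b")
        case True
        then show ?thesis using same u v less.prems by blast
      next
        case False
        have "[a] \<preceq> z" "[a] \<preceq> y" "[b] \<preceq> z" "[b] \<preceq> y"
          using less.prems u v ldvd_ConsE letter_ldvd by metis+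
        then obtain n where n: "m a b = enat n" "2 \<le> n" "alt_word n a b \<preceq> z" "alt_word n b a \<preceq> z"
            "alt_word n a b \<preceq> y" "alt_word n b a \<preceq> y"
          using reduced_dihedral_ldvd[OF less.prems(2) _ _ False]
            dihedral_ldvd_upto[OF assms(1) less.prems(1) _ _ False] by (metis enat.inject)
        obtain t where t: "t \<preceq> z" "t \<preceq> y" "u \<preceq> t" "alt_word n a b \<preceq> t"
          using same[of a u' "alt_word (n - 1) b a"] n less.prems u by (auto simp: alt_word_Cons)
        have ab: "a \<in> I" "b \<in> I" using \<open>[a] \<preceq> z\<close> \<open>[b] \<preceq> z\<close> ldvdE by (metis Cons_in_lists_iff)+
        \<comment> \<open>The braid relation yields an expression of \<open>t\<close> starting with
          \<open>b\<close>, so that \<open>same\<close> applies once more, now to this expression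
          and \<open>v\<close>.\<close>
        have "alt_word n b a \<preceq> t" using ldvd_cong_left[OF t(4) A_alt[OF ab False n(1)]] .
        then obtain r where r: "b # r \<sim>\<^sub>A t" using n(2) ldvd_ConsE[of b "alt_word (n - 1) a b" t]
          by (auto simp: alt_word_Cons)
        have "b # r \<preceq> z" "b # r \<preceq> y" using t r A_sym ldvd_cong_left by blast+
        then obtain t' where t': "t' \<preceq> z" "t' \<preceq> y" "v \<preceq> t'" "b # r \<preceq> t'"
          using same[of b v' r] less.prems v by blast
        have "t \<preceq> t'" using t'(4) r ldvd_cong_left by blast
        then show ?thesis using t' t(3) ldvd_trans by blast
      qed
    qed
  qed
qed

text \<open>The main case has \<open>a\<close>, \<open>c\<close> different from \<open>b\<close> and
  from each other. Then \<open>y\<close> is divisible by the words that \<open>b\<close> completes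
  to its least common multiples with \<open>a\<close> and with \<open>c\<close>. Both words also lie
  below the reduced word \<open>w\<close> with \<open>b\<close> removed, so they have a joint
  multiple \<open>t\<close> dividing \<open>y\<close> with \<open>b # t\<close> reduced. There
  \<open>a\<close> and \<open>c\<close> can be compared by Matsumoto's theorem; the remaining factor
  \<open>r\<close> of \<open>y\<close> is carried along on the right.\<close>

lemma common_trans:
  assumes l: "common_upto l" "length y \<le> l" and w: "reduced w" "\<And>a. a \<in> I \<Longrightarrow> [a] \<preceq> w"
    and abc: "a \<in> I" "b \<in> I" "c \<in> I" and E: "common a x b y" "common b y c v"
  shows "common a x c v"
proof -
  consider "a = b" | "b = c" | "a \<noteq> b" "b \<noteq> c" by blast
  then show ?thesis
  proof cases
    case 1
    then have "x \<sim>\<^sub>A y" using E by (auto simp: common_def)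
    moreover have "v \<sim>\<^sub>A v" using E(2) A_lists A_refl by (auto simp: common_def)
    ultimately show ?thesis using common_cong[OF E(2) A_sym] 1 by blast
  next
    case 2
    then have "y \<sim>\<^sub>A v" using E by (auto simp: common_def)
    moreover have "x \<sim>\<^sub>A x" using E(1) A_lists A_refl by (auto simp: common_def)
    ultimately show ?thesis using common_cong[OF E(1)] 2 by blast
  next
    case 3
    obtain n z where n: "m a b = enat n" "x \<sim>\<^sub>A alt_word (n - 1) b a @ z" "y \<sim>\<^sub>A alt_word (n - 1) a b @ z"
      using E(1) 3 by (auto simp: common_def)
    obtain n' z' where n': "m b c = enat n'" "y \<sim>\<^sub>A alt_word (n' - 1) c b @ z'" "v \<sim>\<^sub>A alt_word (n' - 1) b c @ z'"
      using E(2) 3 by (auto simp: common_def)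
    have n2: "2 \<le> n" "2 \<le> n'" using m_ge2_nat n n' abc 3 by blast+
    show ?thesis
    proof (cases "a = c")
      case True
      then have "n' = n" using n n' m_sym[of a b] abc by simp
      then have e: "alt_word (n - 1) a b @ z \<sim>\<^sub>A alt_word (n - 1) a b @ z'"
        using n n' True A_sym A_trans by blast
      have "z \<sim>\<^sub>A z'" using cancel_upto[OF l(1) e] A_length[OF n(3)] l(2) by simp
      then have "alt_word (n - 1) b a @ z \<sim>\<^sub>A alt_word (n - 1) b a @ z'" using A_left abc by simp
      then have "x \<sim>\<^sub>A v" using n n' True \<open>n' = n\<close> A_sym A_trans by blast
      then show ?thesis using True by (simp add: common_def)
    next
      case False
      have bI: "[b] \<preceq> w" using w abc by blast
      obtain w1 where w1: "b # w1 \<sim>\<^sub>A w" using bI ldvd_ConsE by metis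
      have rw: "reduced (b # w1)" using w1 w reduced_A A_sym by blast
      \<comment> \<open>The least common multiple of \<open>b\<close> and \<open>d\<close> divides
        \<open>w\<close>; cancelling \<open>b\<close> leaves this divisor of
        \<open>w1\<close>.\<close>
      have pre: "alt_word (k - 1) d b \<preceq> w1" if h: "m b d = enat k" "d \<in> I" "d \<noteq> b" for k d
      proof -
        obtain k' where k: "m b d = enat k'" "2 \<le> k'" "alt_word k' b d \<preceq> w"
          using reduced_dihedral_ldvd[OF w(1) bI w(2)[OF h(2)]] h(3) by metis
        then have "b # alt_word (k - 1) d b \<preceq> b # w1"
          using h A_sym[OF w1] ldvd_cong_right by (auto simp: alt_word_Cons)
        then show ?thesis using ldvd_cancel_reduced[of "[b]"] rw by simp
      qed
      have d1: "alt_word (n - 1) a b \<preceq> w1" using pre[of a n] n m_sym[of a b] abc 3 by auto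
      have d2: "alt_word (n' - 1) c b \<preceq> w1" using pre[of c n'] n' abc 3 by auto
      have d3: "alt_word (n - 1) a b \<preceq> y" "alt_word (n' - 1) c b \<preceq> y" using n n' A_sym ldvdI by blast+
      obtain t where t: "t \<preceq> w1" "t \<preceq> y" "alt_word (n - 1) a b \<preceq> t" "alt_word (n' - 1) c b \<preceq> t"
        using join_upto[OF l reduced_Cons[OF rw] d1 d2 d3] by blast
      obtain q where q: "alt_word (n - 1) a b @ q \<sim>\<^sub>A t" "q \<in> lists I" using t ldvdE by metis
      obtain q' where q': "alt_word (n' - 1) c b @ q' \<sim>\<^sub>A t" "q' \<in> lists I" using t ldvdE by metis
      obtain r where r: "t @ r \<sim>\<^sub>A y" "r \<in> lists I" using t ldvdE by metis
      have "alt_word (n - 1) a b @ z \<sim>\<^sub>A alt_word (n - 1) a b @ (q @ r)"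
        using A_right[OF q(1) r(2)] r(1) n(3) A_sym A_trans by (metis append.assoc)
      then have z: "z \<sim>\<^sub>A q @ r" using cancel_upto[OF l(1)] A_length[OF n(3)] l(2) by metis
      have "alt_word (n' - 1) c b @ z' \<sim>\<^sub>A alt_word (n' - 1) c b @ (q' @ r)"
        using A_right[OF q'(1) r(2)] r(1) n'(2) A_sym A_trans by (metis append.assoc)
      then have z': "z' \<sim>\<^sub>A q' @ r" using cancel_upto[OF l(1)] A_length[OF n'(2)] l(2) by metis
      have redbt: "reduced (b # t)" using ldvd_reduced[OF ldvd_Cons[OF t(1) abc(2)] rw] .
      have swap: "d # alt_word (k - 1) b d @ s \<sim>\<^sub>A b # t"
        if "alt_word (k - 1) d b @ s \<sim>\<^sub>A t" "m b d = enat k" "d \<in> I" "d \<noteq> b" "s \<in> lists I" for k d s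
      proof -
        have k2: "2 \<le> k" using m_ge2_nat that abc by blast
        have "alt_word k d b @ s \<sim>\<^sub>A alt_word k b d @ s"
          using A_right[OF A_alt[of d b k]] that abc m_sym[of b d] by auto
        also have "alt_word k b d @ s \<sim>\<^sub>A b # t" using A_Cons[OF that(1) abc(2)] k2 by (simp add: alt_word_Cons)
        finally show ?thesis using k2 by (simp add: alt_word_Cons)
      qed
      have s1: "a # alt_word (n - 1) b a @ q \<sim>\<^sub>A b # t" using swap[OF q(1)] n m_sym[of a b] abc 3 q by auto
      have s2: "c # alt_word (n' - 1) b c @ q' \<sim>\<^sub>A b # t" using swap[OF q'(1)] n' abc 3 q' by auto
      \<comment> \<open>Both \<open>a\<close> and \<open>c\<close> divide the reduced word
        \<open>b # t\<close>, so their braid relation occurs inside it and supplies the exponent for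
        the conclusion.\<close>
      obtain k where k: "m a c = enat k" "2 \<le> k" "alt_word k a c \<preceq> b # t" "alt_word k c a \<preceq> b # t"
        using reduced_dihedral_ldvd[OF redbt letter_ldvd[OF s1] letter_ldvd[OF s2] False] .
      obtain p where p: "alt_word k a c @ p \<sim>\<^sub>A b # t" "p \<in> lists I" using k ldvdE by metis
      have p': "alt_word k c a @ p \<sim>\<^sub>A b # t"
        using A_right[OF A_alt[OF abc(1,3) False k(1)] p(2)] p(1) A_sym A_trans by blast
      have "[a] @ (alt_word (n - 1) b a @ q) \<sim>\<^sub>A [a] @ (alt_word (k - 1) c a @ p)"
        using A_trans[OF s1 A_sym[OF p(1)]] k(2) by (simp add: alt_word_Cons)
      from cancel_reduced[OF this] reduced_A[OF redbt A_sym[OF s1]]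
      have e1: "alt_word (n - 1) b a @ q \<sim>\<^sub>A alt_word (k - 1) c a @ p" by simp
      have "[c] @ (alt_word (n' - 1) b c @ q') \<sim>\<^sub>A [c] @ (alt_word (k - 1) a c @ p)"
        using A_trans[OF s2 A_sym[OF p']] k(2) by (simp add: alt_word_Cons)
      from cancel_reduced[OF this] reduced_A[OF redbt A_sym[OF s2]]
      have e2: "alt_word (n' - 1) b c @ q' \<sim>\<^sub>A alt_word (k - 1) a c @ p" by simp
      have "x \<sim>\<^sub>A alt_word (k - 1) c a @ (p @ r)"
      proof -
        have "alt_word (n - 1) b a @ z \<sim>\<^sub>A alt_word (n - 1) b a @ (q @ r)" using A_left[OF z] abc by simp
        then show ?thesis using n(2) A_right[OF e1 r(2)] A_trans unfolding append.assoc by blast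
      qed
      moreover have "v \<sim>\<^sub>A alt_word (k - 1) a c @ (p @ r)"
      proof -
        have "alt_word (n' - 1) b c @ z' \<sim>\<^sub>A alt_word (n' - 1) b c @ (q' @ r)" using A_left[OF z'] abc by simp
        then show ?thesis using n'(3) A_right[OF e2 r(2)] A_trans unfolding append.assoc by blast
      qed
      ultimately show ?thesis using k False unfolding common_def by blast
    qed
  qed
qed

text \<open>Induction on the derivation of \<open>a # x \<sim>\<^sub>A b # y\<close>. The substance
  lies in transitivity, where the tail of the middle word has length at most \<open>l\<close>, so
  that \<open>common_trans\<close> applies.\<close>

lemma common_upto_Suc:
  assumes l: "common_upto l" and w: "reduced w" "\<And>a. a \<in> I \<Longrightarrow> [a] \<preceq> w"
  shows "common_upto (Suc l)"
proof -
  have "u \<sim>\<^sub>A v \<Longrightarrow> u = a # x \<Longrightarrow> v = b # y \<Longrightarrow> length x < Suc l \<Longrightarrow> common a x b y" for u v a x b y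
  proof (induction arbitrary: a x b y rule: word_cong.induct)
    case (base u v)
    then obtain i j n where ij: "i \<in> I" "j \<in> I" "i \<noteq> j" "m i j = enat n" "a # x = alt_word n i j" "b # y = alt_word n j i"
      by (auto simp: artin_rels_def)
    then have n: "2 \<le> n" using m_ge2_nat by blast
    then have e: "a = i" "b = j" "x = alt_word (n - 1) j i" "y = alt_word (n - 1) i j"
      using ij(5,6) by (auto simp: alt_word_Cons)
    have "x \<sim>\<^sub>A alt_word (n - 1) j i @ []" "y \<sim>\<^sub>A alt_word (n - 1) i j @ []"
      using e ij by (auto intro: A_refl)
    then show ?case using ij e unfolding common_def by blast
  next
    case (refl u)
    then show ?case by (auto simp: common_def intro: A_refl)
  next
    case (sym u v)
    then have "a \<in> I" "b \<in> I" using A_lists[OF sym(1)] by auto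
    moreover have "length y < Suc l" using A_length[OF sym(1)] sym by simp
    ultimately show ?case using sym common_sym by blast
  next
    case (trans u v u')
    have len: "length v = length u" using A_length[OF trans(1)] by simp
    then obtain c t where c: "v = c # t" using trans by (cases v) auto
    have abc: "a \<in> I" "c \<in> I" "b \<in> I" using A_lists[OF trans(1)] A_lists[OF trans(2)] trans c by auto
    have "length t \<le> l" using len c trans by simp
    moreover from this have "common a x c t" "common c t b y" using trans c by auto
    ultimately show ?case using common_trans[OF l _ w abc] by blast
  next
    case (append u u' v v')
    show ?case
    proof (cases u)
      case Nil
      then have "u' = []" using A_length[OF append(1)] by simp
      then show ?thesis using Nil append by auto
    next
      case (Cons a' s)
      then obtain b' s' where u': "u' = b' # s'" using A_length[OF append(1)] by (cases u') auto
      have e: "a' = a" "b' = b" "x = s @ v" "y = s' @ v'" using append.prems Cons u' by auto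
      have vl: "v \<in> lists I" using A_lists append by blast
      have "common a s b s'" using append.IH(1)[of a s b s'] Cons u' e append.prems by simp
      then have "common a (s @ v) b (s' @ v)"
        using A_right[OF _ vl] unfolding common_def by (metis append.assoc)
      moreover have "s @ v \<sim>\<^sub>A s @ v" "s' @ v \<sim>\<^sub>A s' @ v'"
        using A_lists[OF append(1)] Cons u' vl A_left[OF append(2)] by (auto intro: A_refl)
      ultimately show ?thesis using common_cong e by blast
    qed
  qed
  then show ?thesis unfolding common_upto_def by blast
qed

lemma common_all:
  assumes "reduced w" "\<And>a. a \<in> I \<Longrightarrow> [a] \<preceq> w"
  shows "common_upto l"
proof (induction l)
  case 0
  then show ?case by (simp add: common_upto_def)
qed (use common_upto_Suc assms in blast)

end

section \<open>Finite type: cancellation and common multiples without length bounds\<close>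

locale finite_coxeter = coxeter I m
  for I :: "'i set" and m :: "'i \<Rightarrow> 'i \<Rightarrow> enat" +
  assumes finite_type: "finite_type I m"
begin

lemma reduced_length_eq_coxeter_length:
  assumes "reduced u" shows "length u = coxeter_length (word_class I (coxeter_rels I m) u)"
  unfolding coxeter_length_def word_class_def
  using assms C_refl by (intro Least_equality[symmetric]) (auto simp: reduced_def)

lemma reduced_bounded: "\<exists>B. \<forall>u. reduced u \<longrightarrow> length u \<le> B"
proof -
  have "finite (coxeter_length ` carrier (coxeter_group I m))"
    using finite_type by (simp add: finite_type_def)
  then obtain B where B: "\<And>x. x \<in> coxeter_length ` carrier (coxeter_group I m) \<Longrightarrow> x \<le> B"
    using Max_ge that by blast
  have "length u \<le> B" if "reduced u" for u
    unfolding reduced_length_eq_coxeter_length[OF that] using reduced_lists[OF that]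
    by (intro B) (auto simp: coxeter_group_def presented_monoid_def)
  then show ?thesis by blast
qed

lemma ex_longest: "\<exists>z. longest J z"
proof -
  obtain B where B: "\<And>u. reduced u \<Longrightarrow> length u \<le> B" using reduced_bounded by blast
  have "reduced [] \<and> [] \<in> lists J" by (simp add: reduced_def)
  moreover have "\<forall>y. reduced y \<and> y \<in> lists J \<longrightarrow> length y < Suc B" using B by (simp add: less_Suc_eq_le)
  ultimately have "\<exists>z. (reduced z \<and> z \<in> lists J) \<and> (\<forall>y. reduced y \<and> y \<in> lists J \<longrightarrow> length y \<le> length z)"
    by (rule ex_has_greatest_nat)
  then show ?thesis unfolding longest_def by blast
qed

lemma common_upto: "common_upto l"
proof -
  obtain w where "longest I w" using ex_longest by blast
  then show ?thesis using common_all longest_reduced longest_descent by blast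
qed

lemma A_common: "a # x \<sim>\<^sub>A b # y \<Longrightarrow> common a x b y"
  using common_upto unfolding common_upto_def by blast

lemma A_cancel_left: "p @ x \<sim>\<^sub>A p @ y \<Longrightarrow> x \<sim>\<^sub>A y"
  using cancel_upto[OF common_upto] by blast

lemma A_cancel_Cons: "a # x \<sim>\<^sub>A a # y \<Longrightarrow> x \<sim>\<^sub>A y"
  using A_cancel_left[of "[a]" x y] by simp

lemma A_cancel_right: "x @ p \<sim>\<^sub>A y @ p \<Longrightarrow> x \<sim>\<^sub>A y"
  using A_cancel_left[of "rev p" "rev x" "rev y"] A_rev[of "x @ p" "y @ p"] A_rev[of "rev x" "rev y"] by simp

lemma ldvd_Cons_neq:
  assumes "[a] \<preceq> b # y" "a \<noteq> b"
  obtains n where "m a b = enat n" "2 \<le> n" "alt_word (n - 1) a b \<preceq> y"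
proof -
  obtain x where x: "a # x \<sim>\<^sub>A b # y" "a \<in> I" using assms ldvd_ConsE by metis
  from A_common[OF x(1)] assms obtain n z where n: "m a b = enat n" "y \<sim>\<^sub>A alt_word (n - 1) a b @ z"
    by (auto simp: common_def)
  moreover have "2 \<le> n" using m_ge2_nat[OF _ _ assms(2) n(1)] A_lists[OF x(1)] by auto
  ultimately show ?thesis using that A_sym ldvdI by blast
qed

text \<open>Strip the letters of \<open>u\<close> one at a time: when \<open>b\<close> is removed,
  \<open>a\<close> divides the rest because the alternating word left over from the braid relation
  still starts with \<open>a\<close>.\<close>

lemma letter_ldvd_append:
  assumes "[a] \<preceq> u @ y" "a \<notin> set u" shows "[a] \<preceq> y"
  using assms
proof (induction u)
  case (Cons b u)
  then obtain n where n: "2 \<le> n" "alt_word (n - 1) a b \<preceq> u @ y"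
    using ldvd_Cons_neq[of a b "u @ y"] by auto
  then have "[a] \<preceq> u @ y" using ldvd_ConsE[of a "alt_word (n - 2) b a" "u @ y"] letter_ldvd
    by (metis Suc_1 Suc_diff_Suc Suc_le_lessD alt_word.simps(2) diff_Suc_1 le_simps(3) less_imp_Suc_add numeral_2_eq_2)
  then show ?case using Cons by auto
qed simp

text \<open>The letters of \<open>J\<close> are joined one after another below both \<open>z\<close>
  and \<open>y\<close>. The resulting \<open>t\<close> is divisible by all of \<open>J\<close>,
  hence as long as \<open>z\<close>, hence equal to \<open>z\<close>.\<close>

lemma longest_ldvd:
  assumes "longest J z" "J \<subseteq> I" "y \<in> lists I" "\<And>a. a \<in> J \<Longrightarrow> [a] \<preceq> y"
  shows "z \<preceq> y"
proof -
  have zI: "z \<in> lists I" using longest_reduced[OF assms(1)] reduced_lists by blast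
  have fold: "\<exists>t. t \<preceq> z \<and> t \<preceq> y \<and> (\<forall>a\<in>F. [a] \<preceq> t)" if "finite F" "F \<subseteq> J" for F
    using that
  proof (induction F rule: finite_induct)
    case (insert a F)
    then obtain t where t: "t \<preceq> z" "t \<preceq> y" "\<forall>a\<in>F. [a] \<preceq> t" by auto
    obtain t' where "t' \<preceq> z" "t' \<preceq> y" "t \<preceq> t'" "[a] \<preceq> t'"
      using join_upto[OF common_upto order_refl longest_reduced[OF assms(1)] t(1) _ t(2), of "[a]"]
        longest_descent[OF assms(1,2)] assms(4) insert.prems by blast
    then show ?case using t(3) ldvd_trans by blast
  qed (use Nil_ldvd zI assms in blast)
  have "finite J" using assms(2) finite_I finite_subset by blast
  then obtain t where t: "t \<preceq> z" "t \<preceq> y" "\<forall>a\<in>J. [a] \<preceq> t" using fold[of J] by blast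
  have "t \<in> lists I" using t ldvdE by blast
  then have "length z \<le> length t"
    using descents_length[OF assms(2) _ _ longest_lists[OF assms(1)] longest_reduced[OF assms(1)]] t by blast
  then have "t \<sim>\<^sub>A z" using ldvd_length_eq t by blast
  then show ?thesis using t(2) ldvd_cong_left by blast
qed

lemma longest_unique:
  assumes "longest J z" "longest J z'" "J \<subseteq> I" shows "z \<sim>\<^sub>A z'"
proof -
  have "z \<preceq> z'"
    by (rule longest_ldvd[OF assms(1,3)]) (use assms longest_reduced reduced_lists longest_descent in blast)+
  then show ?thesis using ldvd_length_eq assms by (auto simp: longest_def)
qed

end

section \<open>Quasi-central elements\<close>

context finite_coxeter
begin

text \<open>These sets are the unions of connected components of the Coxeter graph on
  \<open>K\<close>.\<close>

definition adj_closed :: "'i set \<Rightarrow> 'i set \<Rightarrow> bool" where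
  "adj_closed K C \<longleftrightarrow> C \<subseteq> K \<and> (\<forall>a\<in>C. \<forall>b\<in>K. a \<noteq> b \<longrightarrow> 2 < m a b \<longrightarrow> b \<in> C)"

definition quasi_central :: "'i set \<Rightarrow> 'i list \<Rightarrow> bool" where
  "quasi_central K x \<longleftrightarrow> x \<in> lists K \<and> (\<forall>a\<in>K. \<exists>b\<in>K. a # x \<sim>\<^sub>A x @ [b])"

lemma lists_cong: "u \<sim>\<^sub>A v \<Longrightarrow> u \<in> lists K \<Longrightarrow> v \<in> lists K"
  using A_set by (auto simp: in_lists_conv_set)

lemma lists_superset: "u \<in> lists K \<Longrightarrow> K \<subseteq> I \<Longrightarrow> u \<in> lists I"
  by (auto simp: in_lists_conv_set)

lemma letter_ldvd_Cons: "a # u \<in> lists I \<Longrightarrow> [a] \<preceq> a # u"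
  by (rule letter_ldvd[OF A_refl])

lemma quasi_central_cong:
  assumes "quasi_central K x" "x \<sim>\<^sub>A y" "K \<subseteq> I" shows "quasi_central K y"
  unfolding quasi_central_def
proof (intro conjI ballI)
  show "y \<in> lists K" using assms lists_cong by (auto simp: quasi_central_def)
next
  fix a assume a: "a \<in> K"
  then obtain b where b: "b \<in> K" "a # x \<sim>\<^sub>A x @ [b]" using assms by (auto simp: quasi_central_def)
  have "a # y \<sim>\<^sub>A a # x" using A_Cons[OF A_sym[OF assms(2)]] a assms by auto
  also have "a # x \<sim>\<^sub>A x @ [b]" by (rule b)
  also have "x @ [b] \<sim>\<^sub>A y @ [b]" using A_right[OF assms(2)] b assms by auto
  finally show "\<exists>b\<in>K. a # y \<sim>\<^sub>A y @ [b]" using b by blast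
qed

text \<open>A relation between a letter inside \<open>C\<close> and one outside is a commutation; in
  every other relation all letters lie on the same side of \<open>C\<close>, and lengths
  agree.\<close>

lemma count_A:
  assumes "u \<sim>\<^sub>A v" "u \<in> lists K" "K \<subseteq> I" "adj_closed K C"
  shows "length (filter (\<lambda>x. x \<in> C) u) = length (filter (\<lambda>x. x \<in> C) v)"
  using assms(1,2)
proof (induction rule: word_cong.induct)
  case (base u v)
  then obtain i j n where ij: "i \<in> I" "j \<in> I" "i \<noteq> j" "m i j = enat n" "u = alt_word n i j" "v = alt_word n j i"
    by (auto simp: artin_rels_def)
  then have n: "2 \<le> n" using m_ge2_nat by blast
  then have K: "i \<in> K" "j \<in> K" using base(2) ij set_alt_word[OF n, of i j] by (auto simp: in_lists_conv_set)
  have s: "set u = {i, j}" "set v = {i, j}" by (auto simp: ij(5,6) set_alt_word[OF n])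
  show ?case
  proof (cases "i \<in> C \<longleftrightarrow> j \<in> C")
    case True
    then have "(\<forall>x\<in>set u. x \<in> C) \<and> (\<forall>x\<in>set v. x \<in> C) \<or> (\<forall>x\<in>set u. x \<notin> C) \<and> (\<forall>x\<in>set v. x \<notin> C)"
      using s by auto
    then show ?thesis using ij(5,6) by (elim disjE) (auto cong: filter_cong)
  next
    case False
    have "\<not> 2 < m i j"
      using False K assms(4) m_sym[OF ij(1,2)] ij(3) unfolding adj_closed_def by metis
    then have "\<not> 2 < n" using ij(4) by (simp add: numeral_eq_enat)
    then have "n = 2" using n by simp
    then show ?thesis using ij by (simp add: numeral_2_eq_2)
  qed
next
  case (sym u v)
  then show ?case using lists_cong[OF A_sym[OF sym(1)]] by simp
next
  case (trans u v w)
  then show ?case using lists_cong[OF trans(1)] by simp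
qed auto

lemma swap_in_closed_iff:
  assumes "a # x \<sim>\<^sub>A x @ [b]" "a \<in> K" "x \<in> lists K" "K \<subseteq> I" "adj_closed K C"
  shows "a \<in> C \<longleftrightarrow> b \<in> C"
  using count_A[OF assms(1) _ assms(4,5)] assms(2,3) by (auto split: if_splits)

lemma swap_inj:
  assumes "a # x \<sim>\<^sub>A x @ [b]" "a' # x \<sim>\<^sub>A x @ [b]" shows "a = a'"
proof -
  have "[a] @ x \<sim>\<^sub>A [a'] @ x" using A_trans[OF assms(1) A_sym[OF assms(2)]] by simp
  from A_set[OF A_cancel_right[OF this]] show ?thesis by simp
qed

lemma swap_inj_right:
  assumes "a # x \<sim>\<^sub>A x @ [b]" "a # x \<sim>\<^sub>A x @ [b']" shows "b = b'"
  using A_set[OF A_cancel_left[OF A_trans[OF A_sym[OF assms(1)] assms(2)]]] by simp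

text \<open>By right cancellation the map sending \<open>a\<close> to \<open>b\<close> is injective,
  hence a permutation of the finite set \<open>K\<close>.\<close>

lemma quasi_central_surj:
  assumes "quasi_central K x" "K \<subseteq> I" "b \<in> K"
  shows "\<exists>a\<in>K. a # x \<sim>\<^sub>A x @ [b]"
proof -
  obtain f where f: "\<And>a. a \<in> K \<Longrightarrow> f a \<in> K \<and> a # x \<sim>\<^sub>A x @ [f a]"
    using assms(1) unfolding quasi_central_def by metis
  have "finite K" using assms finite_I finite_subset by blast
  moreover have "inj_on f K"
  proof (rule inj_onI)
    fix a a' assume "a \<in> K" "a' \<in> K" "f a = f a'"
    then show "a = a'" using swap_inj[of a x "f a" a'] f by metis
  qed
  ultimately have "f ` K = K" using f by (intro endo_inj_surj) auto
  then show ?thesis using f assms(3) by (metis imageE)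
qed

text \<open>A letter is pulled back through \<open>z\<close> by surjectivity, pushed through
  \<open>z @ x\<close>, and then \<open>z\<close> is cancelled.\<close>

lemma quasi_central_cancel:
  assumes "quasi_central K (z @ x)" "quasi_central K z" "K \<subseteq> I"
  shows "quasi_central K x"
  unfolding quasi_central_def
proof (intro conjI ballI)
  show xK: "x \<in> lists K" using assms by (auto simp: quasi_central_def)
  fix b assume "b \<in> K"
  then obtain a where a: "a \<in> K" "a # z \<sim>\<^sub>A z @ [b]" using quasi_central_surj assms by blast
  then obtain d where d: "d \<in> K" "a # z @ x \<sim>\<^sub>A (z @ x) @ [d]" using assms(1) by (auto simp: quasi_central_def)
  have "(z @ [b]) @ x \<sim>\<^sub>A (a # z) @ x" using A_right[OF A_sym[OF a(2)] lists_superset[OF xK assms(3)]] .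
  from A_trans[OF this, of "(z @ x) @ [d]"] d(2) have "z @ (b # x) \<sim>\<^sub>A z @ (x @ [d])" by simp
  then have "b # x \<sim>\<^sub>A x @ [d]" by (rule A_cancel_left)
  then show "\<exists>d\<in>K. b # x \<sim>\<^sub>A x @ [d]" using d by blast
qed

lemma commuting_letters:
  assumes "a \<in> I" "z \<in> lists I" "\<forall>c\<in>set z. a \<noteq> c \<and> m a c = 2"
  shows "a # z \<sim>\<^sub>A z @ [a]"
  using assms(2,3)
proof (induction z)
  case Nil
  then show ?case using assms by (auto intro: A_refl)
next
  case (Cons c z)
  have "[a, c] \<sim>\<^sub>A [c, a]"
  proof -
    have "m a c = enat (Suc (Suc 0))" "a \<noteq> c" "c \<in> I"
      using Cons by (auto simp: numeral_eq_enat numeral_2_eq_2)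
    then show ?thesis using A_alt[OF assms(1), of c "Suc (Suc 0)"] by simp
  qed
  from A_right[OF this] have "a # c # z \<sim>\<^sub>A c # a # z" using Cons by simp
  also have "c # a # z \<sim>\<^sub>A c # z @ [a]" using Cons by (intro A_Cons) auto
  finally show ?case by simp
qed

lemma not_adjacent:
  assumes "adj_closed K C" "c \<in> C" "a \<in> K" "a \<notin> C" "K \<subseteq> I"
  shows "a \<noteq> c \<and> m a c = 2"
proof -
  have n: "a \<noteq> c" using assms(2,4) by auto
  have aI: "a \<in> I" and cI: "c \<in> I" using assms by (auto simp: adj_closed_def)
  have "\<not> 2 < m c a" using assms n unfolding adj_closed_def by metis
  then show ?thesis using n m_ge2[OF aI cI n] m_sym[OF aI cI] by simp
qed

text \<open>Letters of \<open>K\<close> outside \<open>L\<close> commute with every letter of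
  \<open>z\<close>. Inside \<open>L\<close>, \<open>longest_swap_letter\<close> moves letters from
  right to left; this map is injective on a finite set and can be inverted.\<close>

lemma longest_quasi_central:
  assumes "longest L z" "adj_closed K L" "K \<subseteq> I"
  shows "quasi_central K z"
  unfolding quasi_central_def
proof (intro conjI ballI)
  have LK: "L \<subseteq> K" "L \<subseteq> I" using assms by (auto simp: adj_closed_def)
  have zL: "z \<in> lists L" using longest_lists assms by blast
  show "z \<in> lists K" using zL LK by (auto simp: in_lists_conv_set)
  fix a assume a: "a \<in> K"
  show "\<exists>b\<in>K. a # z \<sim>\<^sub>A z @ [b]"
  proof (cases "a \<in> L")
    case False
    have "a # z \<sim>\<^sub>A z @ [a]"
      using commuting_letters[of a z] not_adjacent[OF assms(2) _ a False assms(3)] zL a assms(3) lists_superset LK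
      by (auto simp: in_lists_conv_set)
    then show ?thesis using a by blast
  next
    case True
    obtain f where f: "\<And>b. b \<in> L \<Longrightarrow> f b \<in> L \<and> f b # z \<sim>\<^sub>A z @ [b]"
      using longest_swap_letter[OF assms(1) LK(2)] by metis
    have "inj_on f L"
    proof (rule inj_onI)
      fix b b' assume "b \<in> L" "b' \<in> L" "f b = f b'"
      then show "b = b'" using swap_inj_right[of "f b" z b b'] f by metis
    qed
    moreover have "finite L" using LK finite_I finite_subset by blast
    ultimately have "f ` L = L" using f by (intro endo_inj_surj) auto
    then obtain b where "b \<in> L" "a = f b" using True by blast
    then show ?thesis using f LK(1) by blast
  qed
qed

text \<open>With \<open>n = m a b \<ge> 3\<close>, the hypothesis on \<open>b\<close> shows that \<open>x\<close> starts with the alternating word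
  \<open>a b \<dots>\<close> of length \<open>n - 1\<close>; after cancelling one \<open>a\<close>, the hypothesis on \<open>a\<close> supplies the missing
  \<open>n\<close>-th letter.\<close>

lemma ldvd_adjacent:
  assumes "[a] \<preceq> x" "a # x \<sim>\<^sub>A x @ u" "b # x \<sim>\<^sub>A x @ v" "a \<noteq> b" "2 < m a b"
  shows "[b] \<preceq> x"
proof -
  have ab: "a \<in> I" "b \<in> I" using A_lists(1)[OF assms(2)] A_lists(1)[OF assms(3)] by simp_all
  have ul: "u \<in> lists I" "v \<in> lists I" using A_lists(2) assms(2,3) by auto
  have "[a] \<preceq> b # x" using ldvd_cong_right[OF ldvd_append[OF assms(1) ul(2)] A_sym[OF assms(3)]] .
  then obtain n where n: "m a b = enat n" "alt_word (n - 1) a b \<preceq> x" using ldvd_Cons_neq assms(4) by blast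
  have n3: "3 \<le> n" using assms(5) n(1) by (simp add: numeral_eq_enat)
  then obtain k where k: "n = k + 3" by (metis le_add_diff_inverse2)
  define w where "w = alt_word (k + 1) b a"
  obtain y where y: "a # w @ y \<sim>\<^sub>A x" using n(2) ldvdE[of "alt_word (n - 1) a b" x]
    by (auto simp: k w_def)
  have yl: "w @ y \<in> lists I" using A_lists[OF y] by simp
  have "a # (a # w @ y) \<sim>\<^sub>A a # x" using A_Cons[OF y ab(1)] .
  also have "a # x \<sim>\<^sub>A x @ u" by (rule assms)
  also have "x @ u \<sim>\<^sub>A (a # w @ y) @ u" using A_right[OF A_sym[OF y] ul(1)] .
  finally have "a # (w @ y) \<sim>\<^sub>A w @ y @ u" using A_cancel_Cons by simp
  moreover have "[b] \<preceq> w @ y @ u" using yl ul letter_ldvd_Cons[of b "alt_word k a b @ y @ u"] by (simp add: w_def)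
  ultimately have "[b] \<preceq> a # (w @ y)" using ldvd_cong_right A_sym by blast
  then obtain n' where n': "m b a = enat n'" "alt_word (n' - 1) b a \<preceq> w @ y" using ldvd_Cons_neq assms(4) by metis
  then have "n' = n" using n m_sym[of a b] ab by simp
  then have "alt_word (Suc (k + 1)) b a \<preceq> w @ y" using n' k by simp
  then obtain c where c: "alt_word (Suc (k + 1)) b a = w @ [c]" "w @ [c] \<preceq> w @ y"
    unfolding w_def by (metis alt_word_snoc)
  then have "a # w @ [c] \<preceq> a # w @ y" using ldvd_Cons ab by simp
  moreover have "a # w @ [c] = alt_word n a b" using c(1)[symmetric] by (simp add: k numeral_3_eq_3)
  ultimately have "alt_word n a b \<preceq> x" using y ldvd_cong_right by metis
  then have "alt_word n b a \<preceq> x" using ldvd_cong_left[OF _ A_alt[OF ab assms(4) n(1)]] by blast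
  then show ?thesis using ldvd_ConsE[of b "alt_word (n - 1) a b" x] letter_ldvd n3 by (auto simp: alt_word_Cons)
qed

lemma ldvd_replicate_neq:
  assumes "[c] \<preceq> replicate (Suc p) b @ x" "c \<noteq> b"
  shows "\<exists>n. m c b = enat n \<and> 2 \<le> n \<and> alt_word (n - 1) c b \<preceq> x"
  using assms(1)
proof (induction p)
  case 0
  then show ?case using ldvd_Cons_neq assms(2) by (metis append_Cons append_Nil replicate_0 replicate_Suc)
next
  case (Suc p)
  then obtain n where n: "m c b = enat n" "2 \<le> n" "alt_word (n - 1) c b \<preceq> replicate (Suc p) b @ x"
    using ldvd_Cons_neq assms(2) by (metis append_Cons replicate_Suc)
  then have "c # alt_word (n - 2) b c \<preceq> replicate (Suc p) b @ x"
    by (metis Suc_1 Suc_diff_Suc Suc_le_lessD alt_word.simps(2) diff_Suc_1 numeral_2_eq_2 less_numeral_extra(3) zero_less_diff Suc_le_eq)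
  then have "[c] \<preceq> replicate (Suc p) b @ x" using ldvd_ConsE letter_ldvd by metis
  then show ?case using Suc.IH by blast
qed

lemma swap_power:
  assumes "b # w \<sim>\<^sub>A w @ [d]" "b \<in> I" "d \<in> I"
  shows "replicate p b @ w \<sim>\<^sub>A w @ replicate p d"
proof (induction p)
  case 0
  then show ?case using A_lists assms by (auto intro: A_refl)
next
  case (Suc p)
  have "b # replicate p b @ w \<sim>\<^sub>A b # w @ replicate p d" using A_Cons[OF Suc assms(2)] .
  also have "b # w @ replicate p d \<sim>\<^sub>A (w @ [d]) @ replicate p d"
    using A_right[OF assms(1), of "replicate p d"] assms(3) by (simp add: in_lists_conv_set)
  finally show ?case by simp
qed

text \<open>If \<open>x\<close> starts with \<open>b\<close>, cancel it. If it starts with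
  \<open>c \<noteq> b\<close>, then \<open>c\<close> also divides the left side, so \<open>x\<close>
  starts with the alternating word \<open>w\<close> that satisfies \<open>b w = w d\<close> by the
  braid relation. Then the power of \<open>b\<close> becomes the same power of \<open>d\<close>
  behind \<open>w\<close>, and the induction continues with \<open>d\<close> and the rest of
  \<open>x\<close>.\<close>

lemma swap_of_power:
  assumes "replicate (Suc p) b @ x \<sim>\<^sub>A x @ u"
  shows "\<exists>d. b # x \<sim>\<^sub>A x @ [d]"
  using assms
proof (induction "length x" arbitrary: b x u rule: less_induct)
  case less
  have bI: "b \<in> I" and xI: "x \<in> lists I" and uI: "u \<in> lists I"
    using A_lists[OF less.prems] by auto
  show ?case
  proof (cases x)
    case Nil
    then show ?thesis using bI A_refl[of "[b]"] by auto
  next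
    case (Cons c v)
    then have cI: "c \<in> I" "v \<in> lists I" using xI by auto
    show ?thesis
    proof (cases "c = b")
      case True
      have "b # (replicate (Suc p) b @ v) \<sim>\<^sub>A b # (v @ u)"
        using less.prems Cons True by (simp add: replicate_app_Cons_same)
      then have "replicate (Suc p) b @ v \<sim>\<^sub>A v @ u" by (rule A_cancel_Cons)
      then obtain d where "b # v \<sim>\<^sub>A v @ [d]" using less.hyps[of v b u] Cons by auto
      then show ?thesis using A_Cons bI Cons True by fastforce
    next
      case False
      have "[c] \<preceq> x @ u" using Cons cI uI by (intro ldvd_append ldvdI[of "[c]" v]) (auto intro: A_refl)
      then have "[c] \<preceq> replicate (Suc p) b @ x" using less.prems ldvd_cong_right A_sym by blast
      then obtain n where n: "m c b = enat n" "2 \<le> n" "alt_word (n - 1) c b \<preceq> x"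
        using ldvd_replicate_neq False by blast
      define w where "w = alt_word (n - 1) c b"
      obtain y where y: "w @ y \<sim>\<^sub>A x" "y \<in> lists I" "w \<in> lists I" using n(3) ldvdE w_def by blast
      obtain d where d: "alt_word (Suc (n - 1)) c b = w @ [d]" "d \<in> I"
        unfolding w_def using alt_word_snoc cI bI by metis
      have "alt_word n b c \<sim>\<^sub>A alt_word n c b" using A_alt[OF cI(1) bI False n(1)] A_sym by blast
      then have bw: "b # w \<sim>\<^sub>A w @ [d]" using d n(2) by (simp add: w_def alt_word_Cons)
      have "w @ (replicate (Suc p) d @ y) \<sim>\<^sub>A replicate (Suc p) b @ w @ y"
        using A_right[OF A_sym[OF swap_power[OF bw bI d(2), of "Suc p"]] y(2)] by simp
      also have "replicate (Suc p) b @ w @ y \<sim>\<^sub>A replicate (Suc p) b @ x"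
        using A_left[OF y(1), of "replicate (Suc p) b"] bI by (simp add: in_lists_conv_set)
      also have "replicate (Suc p) b @ x \<sim>\<^sub>A x @ u" by (rule less.prems)
      also have "x @ u \<sim>\<^sub>A w @ (y @ u)" using A_right[OF A_sym[OF y(1)] uI] by simp
      finally have "replicate (Suc p) d @ y \<sim>\<^sub>A y @ u" by (rule A_cancel_left)
      moreover have "length y < length x" using A_length[OF y(1)] n(2) by (simp add: w_def)
      ultimately obtain e where e: "d # y \<sim>\<^sub>A y @ [e]" using less.hyps by blast
      then have eI: "e \<in> I" using A_lists by fastforce
      have "b # x \<sim>\<^sub>A (b # w) @ y" using A_Cons[OF A_sym[OF y(1)] bI] by simp
      also have "(b # w) @ y \<sim>\<^sub>A (w @ [d]) @ y" using A_right[OF bw y(2)] .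
      also have "(w @ [d]) @ y \<sim>\<^sub>A (w @ y) @ [e]" using A_left[OF e y(3)] by simp
      also have "(w @ y) @ [e] \<sim>\<^sub>A x @ [e]" using A_right[OF y(1)] eI by simp
      finally show ?thesis by blast
    qed
  qed
qed

lemma divisors_adj_closed:
  assumes "\<And>a. a \<in> K \<Longrightarrow> \<exists>b. a # x \<sim>\<^sub>A x @ [b]"
  shows "adj_closed K {a \<in> K. [a] \<preceq> x}"
  unfolding adj_closed_def using ldvd_adjacent assms by blast

text \<open>Let \<open>L\<close> be the set of letters of \<open>K\<close> dividing
  \<open>x\<close>; split off its longest word, \<open>x = z y\<close>. A letter \<open>c\<close> of
  \<open>y\<close> divides \<open>y\<close> by induction, so \<open>z c\<close> divides
  \<open>x\<close>. Since \<open>z c = a z\<close>, the letter \<open>a\<close> lies in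
  \<open>L\<close>, and \<open>c\<close> lies in the same union of components.\<close>

lemma letter_ldvd_quasi_central:
  assumes "quasi_central K x" "K \<subseteq> I" "c \<in> set x"
  shows "[c] \<preceq> x"
  using assms(1,3)
proof (induction "length x" arbitrary: x rule: less_induct)
  case less
  define L where "L = {a \<in> K. [a] \<preceq> x}"
  have L: "adj_closed K L" unfolding L_def
    by (rule divisors_adj_closed) (use less.prems in \<open>auto simp: quasi_central_def\<close>)
  have LI: "L \<subseteq> I" using assms(2) by (auto simp: L_def)
  have xI: "x \<in> lists K" "x \<in> lists I" using less.prems assms(2) lists_superset by (auto simp: quasi_central_def)
  obtain z where z: "longest L z" using ex_longest by blast
  have "z \<preceq> x" using longest_ldvd[OF z LI xI(2)] by (auto simp: L_def)
  then obtain y where y: "z @ y \<sim>\<^sub>A x" "y \<in> lists I" using ldvdE by metis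
  have "c \<in> L"
  proof (cases "c \<in> set z")
    case True
    then show ?thesis using longest_lists[OF z] by (auto simp: in_lists_conv_set)
  next
    case False
    then have cy: "c \<in> set y" using A_set[OF y(1)] less.prems by auto
    have qz: "quasi_central K z" using longest_quasi_central[OF z L assms(2)] .
    have qy: "quasi_central K y"
      using quasi_central_cancel[OF quasi_central_cong[OF less.prems(1) A_sym[OF y(1)] assms(2)] qz assms(2)] .
    obtain a' x' where x': "x = a' # x'" using less.prems by (cases x) auto
    then have "a' \<in> L" using xI letter_ldvd[OF A_refl] by (auto simp: L_def)
    then have "z \<noteq> []" using longest_descent[OF z LI] ldvd_length by fastforce
    then have "length y < length x" using A_length[OF y(1)] by (cases z) auto
    then have "[c] \<preceq> y" using less.hyps qy cy by blast
    moreover have zI: "z \<in> lists I" using longest_lists[OF z] LI lists_superset by blast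
    ultimately have zc: "z @ [c] \<preceq> x" using ldvd_left y ldvd_cong_right by blast
    have cK: "c \<in> K" using less.prems xI by (auto simp: in_lists_conv_set)
    obtain a where a: "a \<in> K" "a # z \<sim>\<^sub>A z @ [c]" using quasi_central_surj[OF qz assms(2) cK] by blast
    have "a # z \<preceq> x" using ldvd_cong_left[OF zc A_sym[OF a(2)]] .
    then have "a \<in> L" using a ldvd_ConsE letter_ldvd unfolding L_def by (metis (no_types, lifting) mem_Collect_eq)
    then show ?thesis using swap_in_closed_iff[OF a(2) a(1) _ assms(2) L] qz by (auto simp: quasi_central_def)
  qed
  then show ?case by (simp add: L_def)
qed

lemma pass_word:
  assumes "\<And>a. a \<in> S \<Longrightarrow> \<exists>b\<in>T. a # x \<sim>\<^sub>A x @ [b]" "S \<subseteq> I" "T \<subseteq> I" "x \<in> lists I" "u \<in> lists S"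
  shows "\<exists>v\<in>lists T. u @ x \<sim>\<^sub>A x @ v"
  using assms(5)
proof (induction u)
  case Nil
  then show ?case using assms(4) by (intro bexI[of _ "[]"]) (auto intro: A_refl)
next
  case (Cons a u)
  then obtain v where v: "v \<in> lists T" "u @ x \<sim>\<^sub>A x @ v" by auto
  obtain b where b: "b \<in> T" "a # x \<sim>\<^sub>A x @ [b]" using assms(1) Cons by auto
  have "a # u @ x \<sim>\<^sub>A (a # x) @ v" using A_Cons[OF v(2), of a] Cons assms(2) by auto
  also have "(a # x) @ v \<sim>\<^sub>A (x @ [b]) @ v" using A_right[OF b(2)] lists_superset[OF v(1) assms(3)] by blast
  finally show ?case using v b by (intro bexI[of _ "b # v"]) auto
qed

text \<open>Moving \<open>z\<close> through \<open>x\<close> gives a word \<open>v\<close> over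
  \<open>S\<close>, since \<open>x\<close> permutes the letters of \<open>S\<close>. This
  \<open>v\<close> is divisible by all of \<open>S\<close> and has the length of \<open>z\<close>,
  so it equals \<open>z\<close>.\<close>

lemma quasi_central_commute:
  assumes "quasi_central K x" "K \<subseteq> I" "adj_closed K S" "longest S z"
  shows "z @ x \<sim>\<^sub>A x @ z"
proof -
  have SK: "S \<subseteq> K" "S \<subseteq> I" using assms by (auto simp: adj_closed_def)
  have xK: "x \<in> lists K" "x \<in> lists I" using assms lists_superset by (auto simp: quasi_central_def)
  have zS: "z \<in> lists S" using longest_lists assms by blast
  have swap: "\<exists>b\<in>S. a # x \<sim>\<^sub>A x @ [b]" if "a \<in> S" for a
  proof -
    have aK: "a \<in> K" using that SK by blast
    then obtain b where b: "a # x \<sim>\<^sub>A x @ [b]" using assms(1) by (auto simp: quasi_central_def)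
    moreover have "b \<in> S" using swap_in_closed_iff[OF b aK xK(1) assms(2,3)] that by blast
    ultimately show ?thesis by blast
  qed
  obtain v where v: "v \<in> lists S" "z @ x \<sim>\<^sub>A x @ v" using pass_word[OF swap SK(2) SK(2) xK(2) zS] by blast
  have "[b] \<preceq> v" if "b \<in> S" for b
  proof -
    have "b \<in> K" using that SK by blast
    then obtain a where a: "a \<in> K" "a # x \<sim>\<^sub>A x @ [b]" using quasi_central_surj[OF assms(1,2)] by blast
    then have "a \<in> S" using swap_in_closed_iff[OF a(2,1) xK(1) assms(2,3)] that by blast
    then have "[a] \<preceq> z" using longest_descent assms(4) SK by blast
    then obtain u where u: "a # u \<sim>\<^sub>A z" using ldvd_ConsE by metis
    have uS: "u \<in> lists S" using lists_cong[OF A_sym[OF u] zS] by simp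
    obtain u' where u': "u' \<in> lists S" "u @ x \<sim>\<^sub>A x @ u'" using pass_word[OF swap SK(2) SK(2) xK(2) uS] by blast
    have "x @ (b # u') \<sim>\<^sub>A (a # x) @ u'" using A_right[OF A_sym[OF a(2)] lists_superset[OF u'(1) SK(2)]] by simp
    also have "(a # x) @ u' \<sim>\<^sub>A a # u @ x" using A_Cons[OF A_sym[OF u'(2)]] a assms(2) by auto
    also have "a # u @ x \<sim>\<^sub>A z @ x" using A_right[OF u xK(2)] by simp
    also have "z @ x \<sim>\<^sub>A x @ v" by (rule v)
    finally have "b # u' \<sim>\<^sub>A v" by (rule A_cancel_left)
    then show ?thesis by (rule letter_ldvd)
  qed
  then have "z \<preceq> v" using longest_ldvd[OF assms(4) SK(2) lists_superset[OF v(1) SK(2)]] by blast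
  moreover have "length v \<le> length z" using A_length[OF v(2)] by simp
  ultimately have "z \<sim>\<^sub>A v" by (rule ldvd_length_eq)
  then have "x @ z \<sim>\<^sub>A x @ v" using A_left xK by blast
  then show ?thesis using v A_sym A_trans by blast
qed

section \<open>Components of the Coxeter graph and quotients of quasi-central elements\<close>

lemma component_adj_closed:
  assumes "C \<in> coxeter_components m K"
  shows "adj_closed K C"
proof -
  define r where "r = {(i, j). i \<in> K \<and> j \<in> K \<and> i \<noteq> j \<and> 2 < m i j}"
  obtain c where c: "c \<in> K" "C = r\<^sup>* `` {c}" using assms unfolding coxeter_components_def r_def[symmetric]
    by (auto elim: quotientE)
  have "x \<in> K" if "(c, x) \<in> r\<^sup>*" for x using that
    by (induction rule: rtrancl_induct) (use c in \<open>auto simp: r_def\<close>)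
  moreover have "b \<in> C" if "a \<in> C" "b \<in> K" "a \<noteq> b" "2 < m a b" "a \<in> K" for a b
  proof -
    have "(a, b) \<in> r" using that by (simp add: r_def)
    then show ?thesis using that(1) c(2) by (auto intro: rtrancl_into_rtrancl)
  qed
  ultimately show ?thesis using c(2) unfolding adj_closed_def by blast
qed

lemma component_subset:
  assumes "adj_closed K L" "c \<in> L"
  obtains C where "C \<in> coxeter_components m K" "c \<in> C" "C \<subseteq> L"
proof -
  define r where "r = {(i, j). i \<in> K \<and> j \<in> K \<and> i \<noteq> j \<and> 2 < m i j}"
  have "x \<in> L" if "(c, x) \<in> r\<^sup>*" for x using that
    by (induction rule: rtrancl_induct) (use assms in \<open>auto simp: r_def adj_closed_def\<close>)
  moreover have "c \<in> K" using assms by (auto simp: adj_closed_def)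
  then have "r\<^sup>* `` {c} \<in> coxeter_components m K"
    unfolding coxeter_components_def r_def[symmetric] by (rule quotientI)
  ultimately show ?thesis using that by blast
qed

text \<open>\<open>P\<close> stands for membership in the parabolic submonoid, with
  \<open>P_gen\<close> describing its generators as quotients of longest words. The set
  \<open>S\<close> varies in the induction because moving \<open>zC\<close> to the front renames the
  letters of \<open>S\<close>.\<close>

lemma quasi_central_quotient:
  assumes KI: "K \<subseteq> I"
    and P_Nil: "P []" and P_append: "\<And>u v. P u \<Longrightarrow> P v \<Longrightarrow> P (u @ v)"
    and P_cong: "\<And>u v. P u \<Longrightarrow> u \<sim>\<^sub>A v \<Longrightarrow> P v"
    and P_gen: "\<And>C J zJ zC r. C \<in> coxeter_components m K \<Longrightarrow> J \<subseteq> C \<Longrightarrow> longest J zJ \<Longrightarrow> longest C zC \<Longrightarrow>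
      zJ @ r \<sim>\<^sub>A zC \<Longrightarrow> P r"
    and "quasi_central K d" "quasi_central S y" "S \<subseteq> K" "y @ x \<sim>\<^sub>A d"
  shows "P x"
  using assms(6-)
proof (induction "length d" arbitrary: d y x S rule: less_induct)
  case less
  note d = less.prems(1) and y = less.prems(2) and SK = less.prems(3) and yx = less.prems(4)
  have SI: "S \<subseteq> I" using SK KI by blast
  have dK: "d \<in> lists K" "d \<in> lists I" using d KI lists_superset by (auto simp: quasi_central_def)
  have yS: "y \<in> lists S" using y by (auto simp: quasi_central_def)
  have yI: "y \<in> lists I" and xI: "x \<in> lists I" using A_lists[OF yx] by auto
  show ?case
  proof (cases d)
    case Nil
    then show ?thesis using P_Nil A_length[OF yx] by simp
  next
    case (Cons c d0)
    have "[c] \<preceq> d" using Cons letter_ldvd_Cons[of c d0] dK(2) by simp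
    moreover have "adj_closed K {a \<in> K. [a] \<preceq> d}"
      by (rule divisors_adj_closed) (use d in \<open>auto simp: quasi_central_def\<close>)
    ultimately obtain C where C: "C \<in> coxeter_components m K" "c \<in> C" "C \<subseteq> {a \<in> K. [a] \<preceq> d}"
      using component_subset[of K "{a \<in> K. [a] \<preceq> d}" c] dK Cons by auto
    have CI: "C \<subseteq> I" "C \<subseteq> K" using C KI by auto
    have adjC: "adj_closed K C" using component_adj_closed C by blast
    obtain zC where zC: "longest C zC" using ex_longest by blast
    have zCI: "zC \<in> lists I" using longest_lists[OF zC] CI lists_superset by blast
    have qzC: "quasi_central K zC" using longest_quasi_central zC adjC KI by blast
    \<comment> \<open>Pull \<open>b\<close> back through \<open>y\<close>, push the result through
      \<open>d\<close>, and cancel \<open>y\<close>. The new letter is known to lie in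
      \<open>K\<close> only.\<close>
    have swapx: "\<exists>e\<in>K. b # x \<sim>\<^sub>A x @ [e]" if "b \<in> S" for b
    proof -
      obtain a where a: "a \<in> S" "a # y \<sim>\<^sub>A y @ [b]" using quasi_central_surj[OF y SI \<open>b \<in> S\<close>] by blast
      obtain e where e: "e \<in> K" "a # d \<sim>\<^sub>A d @ [e]" using d a SK by (auto simp: quasi_central_def)
      have "y @ (b # x) \<sim>\<^sub>A (a # y) @ x" using A_right[OF A_sym[OF a(2)] xI] by simp
      also have "(a # y) @ x \<sim>\<^sub>A a # d" using A_Cons[OF yx] a SI by auto
      also have "a # d \<sim>\<^sub>A d @ [e]" by (rule e)
      also have "d @ [e] \<sim>\<^sub>A (y @ x) @ [e]" using A_right[OF A_sym[OF yx]] e KI by auto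
      finally have "y @ (b # x) \<sim>\<^sub>A y @ (x @ [e])" by simp
      then show ?thesis using A_cancel_left e by blast
    qed
    define S' where "S' = {s \<in> C \<inter> S. \<not> [s] \<preceq> x}"
    have S'sub: "S' \<subseteq> S" "S' \<subseteq> C" "S' \<subseteq> I" using SI by (auto simp: S'_def)
    have adjS': "adj_closed S S'" unfolding adj_closed_def
    proof (intro conjI ballI impI)
      fix a b assume ab: "a \<in> S'" "b \<in> S" "a \<noteq> b" "2 < m a b"
      have "b \<in> C" using adjC ab S'sub SK unfolding adj_closed_def by blast
      moreover have "\<not> [b] \<preceq> x"
      proof
        assume bx: "[b] \<preceq> x"
        obtain e where e: "a # x \<sim>\<^sub>A x @ [e]" using swapx ab S'sub by blast
        obtain f where f: "b # x \<sim>\<^sub>A x @ [f]" using swapx ab by blast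
        have "2 < m b a" using ab m_sym[of a b] S'sub SI by (metis subsetD)
        then have "[a] \<preceq> x" using ldvd_adjacent[OF bx f e] ab by blast
        then show False using ab by (simp add: S'_def)
      qed
      ultimately show "b \<in> S'" using ab by (simp add: S'_def)
    qed (rule S'sub)
    obtain z where z: "longest S' z" using ex_longest by blast
    have zS: "z \<in> lists S" using longest_lists[OF z] S'sub by (auto simp: in_lists_conv_set)
    have zI: "z \<in> lists I" using zS SI lists_superset by blast
    obtain v where v: "v \<in> lists K" "z @ x \<sim>\<^sub>A x @ v" using pass_word[OF swapx SI KI xI zS] by blast
    have notx: "[s] \<preceq> x \<or> s \<in> set y" if "s \<in> C" for s
      using letter_ldvd_append[of s y x] ldvd_cong_right[OF _ A_sym[OF yx]] C that by blast
    \<comment> \<open>A divisor of \<open>x\<close> survives because \<open>z x = x v\<close>. Any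
      other letter of \<open>C\<close> divides \<open>d\<close> and hence occurs in
      \<open>y\<close>, so it belongs to \<open>S'\<close> and divides \<open>z\<close>.\<close>
    have "[s] \<preceq> z @ x" if "s \<in> C" for s
    proof (cases "[s] \<preceq> x")
      case True
      then show ?thesis using ldvd_cong_right[OF ldvd_append A_sym[OF v(2)]] lists_superset[OF v(1) KI] by blast
    next
      case False
      then have "s \<in> S" using notx that yS by (auto simp: in_lists_conv_set)
      then have "s \<in> S'" using False that by (simp add: S'_def)
      then show ?thesis using longest_descent[OF z S'sub(3)] ldvd_append xI by blast
    qed
    then have "zC \<preceq> z @ x" using longest_ldvd[OF zC CI(1)] zI xI by simp
    then obtain x' where x': "zC @ x' \<sim>\<^sub>A z @ x" "x' \<in> lists I" using ldvdE by metis
    have "z \<preceq> zC" using longest_ldvd[OF z S'sub(3) zCI] longest_descent[OF zC CI(1)] S'sub by blast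
    then obtain r where r: "z @ r \<sim>\<^sub>A zC" "r \<in> lists I" using ldvdE by metis
    have "z @ (r @ x') \<sim>\<^sub>A z @ x" using A_trans[OF A_right[OF r(1) x'(2)] x'(1)] by simp
    then have rx': "r @ x' \<sim>\<^sub>A x" by (rule A_cancel_left)
    have Pr: "P r" using P_gen C z zC r S'sub by blast
    \<comment> \<open>Such a letter must occur in \<open>y\<close>, and letters occurring in a
      quasi-central element divide it.\<close>
    have "[s] \<preceq> y" if "s \<in> S'" for s
      using notx[of s] letter_ldvd_quasi_central[OF y SI] that by (auto simp: S'_def)
    then have "z \<preceq> y" using longest_ldvd[OF z S'sub(3) yI] by blast
    then obtain y' where y': "z @ y' \<sim>\<^sub>A y" "y' \<in> lists I" using ldvdE by metis
    have y'S: "y' \<in> lists S" using lists_cong[OF A_sym[OF y'(1)] yS] by simp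
    have qy': "quasi_central S y'"
      using quasi_central_cancel[OF quasi_central_cong[OF y A_sym[OF y'(1)] SI] longest_quasi_central[OF z adjS' SI] SI] .
    have y'z: "y' @ z \<sim>\<^sub>A y" using quasi_central_commute[OF qy' SI adjS' z] y'(1) A_sym A_trans by blast
    have dd: "y' @ zC @ x' \<sim>\<^sub>A d"
    proof -
      have "y' @ (zC @ x') \<sim>\<^sub>A y' @ (z @ x)" using A_left[OF x'(1) y'(2)] .
      also have "y' @ (z @ x) \<sim>\<^sub>A y @ x" using A_right[OF y'z xI] by simp
      finally show ?thesis using yx A_trans by blast
    qed
    obtain \<theta> where \<theta>: "\<And>a. a \<in> K \<Longrightarrow> \<theta> a \<in> K \<and> a # zC \<sim>\<^sub>A zC @ [\<theta> a]"
      using qzC unfolding quasi_central_def by metis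
    have \<theta>S: "\<theta> ` S \<subseteq> K" "\<theta> ` S \<subseteq> I" using \<theta> SK KI by auto
    obtain y'' where y'': "y'' \<in> lists (\<theta> ` S)" "y' @ zC \<sim>\<^sub>A zC @ y''"
      using pass_word[of S "\<theta> ` S" zC y'] \<theta> SK SI \<theta>S(2) zCI y'S by blast
    have y''I: "y'' \<in> lists I" using y'' \<theta>S lists_superset by blast
    have qy'': "quasi_central (\<theta> ` S) y''"
      unfolding quasi_central_def
    proof (intro conjI ballI y'')
      fix t assume "t \<in> \<theta> ` S"
      then obtain a where a: "a \<in> S" "t = \<theta> a" by blast
      then obtain b where b: "b \<in> S" "a # y' \<sim>\<^sub>A y' @ [b]" using qy' by (auto simp: quasi_central_def)
      have bI: "\<theta> b \<in> I" "a \<in> I" using \<theta>S a b SI by auto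
      have "zC @ (\<theta> a # y'') \<sim>\<^sub>A (a # zC) @ y''" using A_right[OF A_sym y''I] \<theta>[of a] a SK by fastforce
      also have "(a # zC) @ y'' \<sim>\<^sub>A a # y' @ zC" using A_Cons[OF A_sym[OF y''(2)] bI(2)] by simp
      also have "a # y' @ zC \<sim>\<^sub>A (y' @ [b]) @ zC" using A_right[OF b(2) zCI] by simp
      also have "(y' @ [b]) @ zC \<sim>\<^sub>A y' @ zC @ [\<theta> b]" using A_left[OF _ y'(2), of "b # zC" "zC @ [\<theta> b]"] \<theta>[of b] b SK by auto
      also have "y' @ zC @ [\<theta> b] \<sim>\<^sub>A (zC @ y'') @ [\<theta> b]" using A_right[OF y''(2), of "[\<theta> b]"] bI by simp
      finally have "zC @ (\<theta> a # y'') \<sim>\<^sub>A zC @ (y'' @ [\<theta> b])" by simp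
      then have "t # y'' \<sim>\<^sub>A y'' @ [\<theta> b]" using A_cancel_left a by blast
      then show "\<exists>b\<in>\<theta> ` S. t # y'' \<sim>\<^sub>A y'' @ [b]" using b by blast
    qed
    have dz: "zC @ (y'' @ x') \<sim>\<^sub>A d" using A_trans[OF A_right[OF A_sym[OF y''(2)] x'(2)], of d] dd by simp
    have qd': "quasi_central K (y'' @ x')"
      using quasi_central_cancel[OF quasi_central_cong[OF d A_sym[OF dz] KI] qzC KI] .
    have "zC \<noteq> []" using longest_descent[OF zC CI(1) C(2)] ldvd_length by fastforce
    then have "length (y'' @ x') < length d" using A_length[OF dz] by (cases zC) auto
    then have "P x'" using less.hyps[of "y'' @ x'" "\<theta> ` S" y'' x'] qd' qy'' \<theta>S y''I x'(2) A_refl by auto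
    then show ?thesis using P_append Pr P_cong rx' by blast
  qed
qed

end

section \<open>Parabolic elements and light homomorphisms\<close>

lemma word_class_eq:
  assumes "word_cong X R u v" shows "word_class X R u = word_class X R v"
  unfolding word_class_def using assms word_cong.sym word_cong.trans by blast

lemma word_class_eq_iff:
  assumes "v \<in> lists X"
  shows "word_class X R u = word_class X R v \<longleftrightarrow> word_cong X R u v"
proof
  assume "word_class X R u = word_class X R v"
  then have "v \<in> word_class X R u" using word_cong.refl[OF assms] by (simp add: word_class_def)
  then show "word_cong X R u v" by (simp add: word_class_def)
qed (rule word_class_eq)

lemma presented_monoid_mult:
  assumes "u \<in> lists X" "v \<in> lists X"
  shows "word_class X R u \<otimes>\<^bsub>presented_monoid X R\<^esub> word_class X R v = word_class X R (u @ v)"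
proof -
  have e: "word_class X R (u' @ v') = word_class X R (u @ v)"
    if "u' \<in> word_class X R u" "v' \<in> word_class X R v" for u' v'
    by (rule word_class_eq[OF word_cong.append[OF word_cong.sym word_cong.sym]])
      (use that in \<open>auto simp: word_class_def\<close>)
  have "word_class X R u \<otimes>\<^bsub>presented_monoid X R\<^esub> word_class X R v =
      (\<Union>u'\<in>word_class X R u. \<Union>v'\<in>word_class X R v. word_class X R (u' @ v'))"
    by (simp add: presented_monoid_def)
  also have "\<dots> = (\<Union>u'\<in>word_class X R u. \<Union>v'\<in>word_class X R v. word_class X R (u @ v))"
    by (simp add: e cong: SUP_cong)
  also have "\<dots> = word_class X R (u @ v)"
    using word_cong.refl[OF assms(1)] word_cong.refl[OF assms(2)] by (auto simp: word_class_def)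
  finally show ?thesis .
qed

lemma presented_monoid_carrier: "carrier (presented_monoid X R) = word_class X R ` lists X"
  and presented_monoid_one: "\<one>\<^bsub>presented_monoid X R\<^esub> = word_class X R []"
  by (simp_all add: presented_monoid_def)

context coxeter
begin

lemma artin_mult:
  "u \<in> lists I \<Longrightarrow> v \<in> lists I \<Longrightarrow>
    artin_class I m u \<otimes>\<^bsub>artin_monoid I m\<^esub> artin_class I m v = artin_class I m (u @ v)"
  unfolding artin_monoid_def artin_class_def by (rule presented_monoid_mult)

lemma artin_carrier: "carrier (artin_monoid I m) = artin_class I m ` lists I"
  and artin_one: "\<one>\<^bsub>artin_monoid I m\<^esub> = artin_class I m []"
  unfolding artin_monoid_def artin_class_def
  by (simp_all add: presented_monoid_carrier presented_monoid_one fun_eq_iff)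

lemma artin_class_eq: "u \<sim>\<^sub>A v \<Longrightarrow> artin_class I m u = artin_class I m v"
  unfolding artin_class_def by (rule word_class_eq)

lemma artin_class_eq_iff: "v \<in> lists I \<Longrightarrow> artin_class I m u = artin_class I m v \<longleftrightarrow> u \<sim>\<^sub>A v"
  unfolding artin_class_def by (rule word_class_eq_iff)

abbreviation W :: "'i list set monoid" where "W \<equiv> coxeter_group I m"
abbreviation W_class :: "'i list \<Rightarrow> 'i list set" where "W_class \<equiv> word_class I (coxeter_rels I m)"

lemma coxeter_group_group: "group W"
proof (rule groupI)
  note s = coxeter_group_def presented_monoid_carrier presented_monoid_one presented_monoid_mult
  fix x assume "x \<in> carrier W"
  then obtain u where u: "u \<in> lists I" "x = W_class u" by (auto simp: s)
  show "\<one>\<^bsub>W\<^esub> \<otimes>\<^bsub>W\<^esub> x = x" using u by (simp add: s)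
  have "W_class (rev u) \<otimes>\<^bsub>W\<^esub> x = \<one>\<^bsub>W\<^esub>"
    using u word_class_eq[OF C_rev_left[OF u(1)]] by (simp add: s)
  then show "\<exists>y\<in>carrier W. y \<otimes>\<^bsub>W\<^esub> x = \<one>\<^bsub>W\<^esub>"
    using u by (intro bexI[of _ "W_class (rev u)"]) (auto simp: s)
  fix y assume "y \<in> carrier W"
  then obtain v where v: "v \<in> lists I" "y = W_class v" by (auto simp: s)
  show "x \<otimes>\<^bsub>W\<^esub> y \<in> carrier W" using u v by (simp add: s)
  fix z assume "z \<in> carrier W"
  then obtain w where w: "w \<in> lists I" "z = W_class w" by (auto simp: s)
  show "x \<otimes>\<^bsub>W\<^esub> y \<otimes>\<^bsub>W\<^esub> z = x \<otimes>\<^bsub>W\<^esub> (y \<otimes>\<^bsub>W\<^esub> z)" using u v w by (simp add: s)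
next
  show "\<one>\<^bsub>W\<^esub> \<in> carrier W"
    by (simp add: coxeter_group_def presented_monoid_carrier presented_monoid_one)
qed

text \<open>Each generator is its own inverse, so the classes of words over \<open>J\<close> already
  form a subgroup.\<close>

lemma coxeter_parabolic_eq:
  assumes "J \<subseteq> I"
  shows "coxeter_parabolic I m J = W_class ` lists J"
proof -
  interpret W: group W by (rule coxeter_group_group)
  note s = coxeter_group_def presented_monoid_carrier presented_monoid_one presented_monoid_mult
  have gen: "W_class [a] \<in> carrier W" "inv\<^bsub>W\<^esub> (W_class [a]) = W_class [a]" if "a \<in> J" for a
  proof -
    have a: "a \<in> I" using that assms by blast
    then show c: "W_class [a] \<in> carrier W" by (simp add: s)
    have "W_class [a] \<otimes>\<^bsub>W\<^esub> W_class [a] = \<one>\<^bsub>W\<^esub>"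
      using a word_class_eq[OF C_square[OF a]] by (simp add: s)
    then show "inv\<^bsub>W\<^esub> (W_class [a]) = W_class [a]" using c by (intro W.inv_equality)
  qed
  have mult: "W_class u \<otimes>\<^bsub>W\<^esub> W_class v = W_class (u @ v)" if "u \<in> lists J" "v \<in> lists J" for u v
    using that assms by (simp add: s subset_iff in_lists_conv_set)
  show ?thesis
  proof
    show "coxeter_parabolic I m J \<subseteq> W_class ` lists J"
    proof
      fix x assume "x \<in> coxeter_parabolic I m J"
      then show "x \<in> W_class ` lists J" unfolding coxeter_parabolic_def
      proof (induction rule: generate.induct)
        case one
        then show ?case by (auto simp: s)
      next
        case (incl h)
        then show ?case by (auto simp: coxeter_gen_def)
      next
        case (inv h)
        then obtain a where "a \<in> J" "h = W_class [a]" by (auto simp: coxeter_gen_def)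
        then show ?case using gen(2) by auto
      next
        case (eng h1 h2)
        then show ?case using mult by auto
      qed
    qed
  next
    have "W_class u \<in> coxeter_parabolic I m J" if "u \<in> lists J" for u
      using that unfolding coxeter_parabolic_def
    proof (induction u)
      case Nil
      then show ?case using generate.one[of W] by (simp add: s)
    next
      case (Cons a u)
      then have "W_class [a] \<otimes>\<^bsub>W\<^esub> W_class u \<in> generate W (coxeter_gen I m ` J)"
        by (intro generate.eng[OF generate.incl]) (auto simp: coxeter_gen_def)
      then show ?case using mult[of "[a]" u] Cons by simp
    qed
    then show "W_class ` lists J \<subseteq> coxeter_parabolic I m J" by blast
  qed
qed

end

context finite_coxeter
begin

lemma coxeter_length_W_class:
  assumes "reduced r" "u \<sim>\<^sub>C r" shows "coxeter_length (W_class u) = length r"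
  using reduced_length_eq_coxeter_length[OF assms(1)] word_class_eq[OF assms(2)] by simp

text \<open>The element chosen by \<open>arg_max\<close> has a reduced expression over
  \<open>J\<close>, which is itself a longest word; \<open>longest_unique\<close> identifies it with
  \<open>z\<close>.\<close>

lemma longest_elt_eq:
  assumes "J \<subseteq> I" "longest J z"
  shows "longest_elt I m J = W_class z"
proof -
  have le: "coxeter_length w < Suc (length z)" if w: "w \<in> coxeter_parabolic I m J" for w
  proof -
    obtain u where u: "u \<in> lists J" "w = W_class u" using w coxeter_parabolic_eq[OF assms(1)] by auto
    obtain r where r: "reduced r" "r \<in> lists J" "u \<sim>\<^sub>C r" using ex_reduced_parabolic[OF u(1) assms(1)] by blast
    then show ?thesis using coxeter_length_W_class[OF r(1,3)] assms(2) u by (auto simp: longest_def less_Suc_eq_le)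
  qed
  have zw: "W_class z \<in> coxeter_parabolic I m J"
    using coxeter_parabolic_eq[OF assms(1)] longest_lists[OF assms(2)] by auto
  define w where "w = longest_elt I m J"
  have wJ: "w \<in> coxeter_parabolic I m J"
    unfolding w_def longest_elt_def
    by (rule arg_max_natI[of "\<lambda>w. w \<in> coxeter_parabolic I m J", OF zw]) (use le in blast)
  have wz: "coxeter_length (W_class z) \<le> coxeter_length w"
    unfolding w_def longest_elt_def
    by (rule arg_max_nat_le[of "\<lambda>w. w \<in> coxeter_parabolic I m J", OF zw]) (use le in blast)
  obtain u where u: "u \<in> lists J" "w = W_class u" using wJ coxeter_parabolic_eq[OF assms(1)] by auto
  obtain r where r: "reduced r" "r \<in> lists J" "u \<sim>\<^sub>C r" using ex_reduced_parabolic[OF u(1) assms(1)] by blast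
  have rz: "reduced z" using longest_reduced assms(2) by blast
  have zI: "z \<in> lists I" using rz reduced_lists by blast
  have "length z \<le> length r"
    using wz coxeter_length_W_class[OF r(1,3)] coxeter_length_W_class[OF rz C_refl[OF zI]] u(2) by simp
  then have "longest J r" using r assms(2) unfolding longest_def by (meson order_trans)
  then have "r \<sim>\<^sub>A z" using longest_unique assms by blast
  then have "u \<sim>\<^sub>C z" using r(3) A_imp_C C_trans by blast
  then show ?thesis using word_class_eq u(2) w_def by metis
qed

text \<open>Removes the arbitrary choice in \<open>artin_lift\<close>: any two reduced expressions
  agree in the monoid by Matsumoto's theorem.\<close>

lemma artin_lift_reduced:
  assumes "reduced r"
  shows "artin_lift I m (W_class r) = artin_class I m r"
proof -
  have rI: "r \<in> lists I" using assms reduced_lists by blast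
  have len: "coxeter_length (W_class r) = length r" using coxeter_length_W_class[OF assms C_refl[OF rI]] .
  define u where "u = (SOME u. reduced_expression u (W_class r))"
  have "reduced_expression r (W_class r)"
    using len C_refl[OF rI] by (simp add: reduced_expression_def word_class_def)
  then have "reduced_expression u (W_class r)" unfolding u_def by (rule someI)
  then have u: "r \<sim>\<^sub>C u" "length u = length r" using len by (auto simp: reduced_expression_def word_class_def)
  then have "reduced u" using reduced_cong[OF assms] by simp
  then have "r \<sim>\<^sub>A u" using matsumoto assms u by blast
  then show ?thesis unfolding artin_lift_def u_def[symmetric] by (simp add: artin_class_eq)
qed

text \<open>The reversal of \<open>zJ\<close> is again longest, so \<open>zJ\<close> is an
  involution in the group and the parabolic element is represented by \<open>r\<close>. As a suffix
  of a reduced word, \<open>r\<close> is reduced.\<close>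

lemma artin_lift_parabolic_elt:
  assumes "J \<subseteq> C" "C \<subseteq> I" "longest J zJ" "longest C zC" "zJ @ r \<sim>\<^sub>A zC"
  shows "artin_lift I m (parabolic_elt I m J C) = artin_class I m r"
proof -
  have JI: "J \<subseteq> I" using assms by blast
  have l: "zJ \<in> lists I" "r \<in> lists I" "zC \<in> lists I" using A_lists[OF assms(5)] by auto
  have "reduced (zJ @ r)" using reduced_A[OF longest_reduced[OF assms(4)] A_sym[OF assms(5)]] .
  then have rr: "reduced r" using reduced_append by blast
  have "zJ \<sim>\<^sub>C rev zJ" using longest_unique[OF assms(3) longest_rev[OF assms(3)] JI] A_imp_C by blast
  then have "zJ @ zJ \<sim>\<^sub>C zJ @ rev zJ" using C_left l by blast
  then have sq: "zJ @ zJ \<sim>\<^sub>C []" using C_rev_right l C_trans by blast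
  have "zJ @ zC \<sim>\<^sub>C zJ @ zJ @ r" using C_left[OF C_sym[OF A_imp_C[OF assms(5)]] l(1)] .
  also have "zJ @ zJ @ r \<sim>\<^sub>C r" using C_right[OF sq l(2)] by simp
  finally have "W_class (zJ @ zC) = W_class r" by (rule word_class_eq)
  then have "parabolic_elt I m J C = W_class r"
    unfolding parabolic_elt_def longest_elt_eq[OF JI assms(3)] longest_elt_eq[OF assms(2,4)]
    by (simp add: coxeter_group_def presented_monoid_mult l)
  then show ?thesis using artin_lift_reduced[OF rr] by simp
qed

lemma quasi_central_append:
  assumes "quasi_central K x" "quasi_central K y" "K \<subseteq> I"
  shows "quasi_central K (x @ y)"
  unfolding quasi_central_def
proof (intro conjI ballI)
  have l: "x \<in> lists K" "y \<in> lists K" using assms by (auto simp: quasi_central_def)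
  then show "x @ y \<in> lists K" by simp
  fix a assume "a \<in> K"
  then obtain b where b: "b \<in> K" "a # x \<sim>\<^sub>A x @ [b]" using assms(1) by (auto simp: quasi_central_def)
  then obtain c where c: "c \<in> K" "b # y \<sim>\<^sub>A y @ [c]" using assms(2) by (auto simp: quasi_central_def)
  have "(a # x) @ y \<sim>\<^sub>A (x @ [b]) @ y" using A_right[OF b(2)] lists_superset[OF l(2) assms(3)] by blast
  also have "(x @ [b]) @ y \<sim>\<^sub>A x @ (y @ [c])" using A_left[OF c(2)] lists_superset[OF l(1) assms(3)] by simp
  finally show "\<exists>c\<in>K. a # x @ y \<sim>\<^sub>A (x @ y) @ [c]" using c by auto
qed

text \<open>The factor \<open>z'\<close> brings in the other components: for \<open>J = C\<close>
  the product is quasi-central for all of \<open>I\<close>, so its image under a light homomorphism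
  is quasi-central for the full support of the homomorphism.\<close>

lemma quasi_central_component:
  assumes "adj_closed I C" "J \<subseteq> C" "longest J z" "longest (I - C) z'"
  shows "quasi_central (J \<union> (I - C)) (z' @ z)"
proof -
  have CI: "C \<subseteq> I" using assms by (simp add: adj_closed_def)
  have KI: "J \<union> (I - C) \<subseteq> I" using CI assms(2) by blast
  have adjJ: "adj_closed (J \<union> (I - C)) J"
    unfolding adj_closed_def
  proof (intro conjI ballI impI)
    fix a b assume ab: "a \<in> J" "b \<in> J \<union> (I - C)" "a \<noteq> b" "2 < m a b"
    have "a \<in> C" "b \<in> I" using ab assms(2) KI by auto
    then have "b \<in> C" using assms(1) ab(3,4) unfolding adj_closed_def by metis
    then show "b \<in> J" using ab(2) by blast
  qed blast
  have adjC: "adj_closed (J \<union> (I - C)) (I - C)"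
    unfolding adj_closed_def
  proof (intro conjI ballI impI)
    fix a b assume ab: "a \<in> I - C" "b \<in> J \<union> (I - C)" "a \<noteq> b" "2 < m a b"
    show "b \<in> I - C"
    proof (rule ccontr)
      assume "b \<notin> I - C"
      then have b: "b \<in> C" "b \<in> I" using ab assms(2) CI by auto
      then have "2 < m b a" using ab m_sym[of a b] by auto
      then have "a \<in> C" using assms(1) ab b unfolding adj_closed_def by (metis DiffD1)
      then show False using ab(1) by blast
    qed
  qed blast
  show ?thesis
    using quasi_central_append[OF longest_quasi_central[OF assms(4) adjC KI] longest_quasi_central[OF assms(3) adjJ KI] KI] .
qed

end

theorem theorem1p6:
  fixes Ih :: "'a set" and mh :: "'a \<Rightarrow> 'a \<Rightarrow> enat"
    and I :: "'b set" and m :: "'b \<Rightarrow> 'b \<Rightarrow> enat"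
    and \<Phi> :: "'a list set \<Rightarrow> 'b list set"
  assumes "coxeter_matrix Ih mh" and "finite_type Ih mh"
    and "coxeter_matrix I m" and "finite_type I m"
    and "\<Phi> \<in> hom (artin_monoid Ih mh) (artin_monoid I m)"
    and "\<Phi> \<one>\<^bsub>artin_monoid Ih mh\<^esub> = \<one>\<^bsub>artin_monoid I m\<^esub>"
    and "light Ih mh \<Phi>"
  shows "parabolic_hom Ih mh I m \<Phi>"
proof -
  interpret h: finite_coxeter Ih mh using assms by unfold_locales
  interpret t: finite_coxeter I m using assms by unfold_locales
  define g where "g i = (SOME u. u \<in> lists I \<and> \<Phi> (artin_gen Ih mh i) = artin_class I m u)" for i
  have g: "g i \<in> lists I \<and> \<Phi> (artin_gen Ih mh i) = artin_class I m (g i)" if "i \<in> Ih" for i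
  proof -
    have "artin_gen Ih mh i \<in> carrier (artin_monoid Ih mh)"
      using that by (simp add: h.artin_carrier artin_gen_def)
    then have "\<Phi> (artin_gen Ih mh i) \<in> artin_class I m ` lists I"
      using assms(5) t.artin_carrier by (auto simp: hom_def)
    then show ?thesis unfolding g_def by (intro someI_ex[of "\<lambda>u. u \<in> lists I \<and> _ u"]) auto
  qed
  have supp_g: "artin_supp (\<Phi> (artin_gen Ih mh i)) = set (g i)" if "i \<in> Ih" for i
  proof -
    have "g i \<in> artin_class I m (g i)"
      using g[OF that] t.A_refl by (simp add: artin_class_def word_class_def)
    moreover have "set u = set (g i)" if "u \<in> artin_class I m (g i)" for u
      using that t.A_set[of "g i" u] by (simp add: artin_class_def word_class_def)
    ultimately have "(\<Union>u\<in>artin_class I m (g i). set u) = set (g i)" by (intro equalityI UN_least) blast+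
    then show ?thesis using g[OF that] unfolding artin_supp_def by simp
  qed
  define K where "K = hom_supp Ih mh \<Phi> Ih"
  have K: "K = (\<Union>i\<in>Ih. set (g i))" using supp_g by (auto simp: K_def hom_supp_def)
  have KI: "K \<subseteq> I" using g K by (auto simp: in_lists_conv_set)
  \<comment> \<open>Lightness: at most one letter occurs in \<open>g i\<close>. Generators mapped to
    the identity have empty \<open>g i\<close> and are excluded by the choice of
    \<open>a\<close>.\<close>
  have power: "g i = replicate (length (g i)) a" if "i \<in> Ih" "a \<in> set (g i)" for i a
  proof -
    have "card (set (g i)) \<le> 1" using assms(7) supp_g that by (auto simp: light_def hom_supp_def)
    then have "\<forall>x\<in>set (g i). x = a" using that by (metis List.finite_set card_le_Suc0_iff_eq One_nat_def)
    then show ?thesis by (simp add: replicate_eqI)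
  qed
  \<comment> \<open>A lift of \<open>\<Phi>\<close> to words; it respects the Artin congruence
    because \<open>\<Phi>\<close> is well defined on classes.\<close>
  define F where "F u = concat (map g u)" for u
  have F_append: "F (u @ v) = F u @ F v" for u v by (simp add: F_def)
  have F_lists: "F u \<in> lists (\<Union>i\<in>J. set (g i))" if "u \<in> lists J" for u J
    using that by (auto simp: F_def in_lists_conv_set)
  have F_I: "F u \<in> lists I" if "u \<in> lists Ih" for u
    using F_lists[OF that] KI by (auto simp: K in_lists_conv_set)
  have \<Phi>F: "\<Phi> (artin_class Ih mh u) = artin_class I m (F u)" if "u \<in> lists Ih" for u
    using that
  proof (induction u)
    case Nil
    then show ?case using assms(6) by (simp add: h.artin_one t.artin_one F_def)
  next
    case (Cons a u)
    have "artin_class Ih mh (a # u) = artin_gen Ih mh a \<otimes>\<^bsub>artin_monoid Ih mh\<^esub> artin_class Ih mh u"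
      using h.artin_mult[of "[a]" u] Cons by (simp add: artin_gen_def)
    moreover have "artin_gen Ih mh a \<in> carrier (artin_monoid Ih mh)" "artin_class Ih mh u \<in> carrier (artin_monoid Ih mh)"
      using Cons by (auto simp: h.artin_carrier artin_gen_def)
    ultimately have "\<Phi> (artin_class Ih mh (a # u)) = artin_class I m (g a) \<otimes>\<^bsub>artin_monoid I m\<^esub> artin_class I m (F u)"
      using assms(5) g Cons by (simp add: hom_def)
    then show ?case using t.artin_mult g F_I Cons by (simp add: F_def)
  qed
  have F_cong: "word_cong I (artin_rels I m) (F u) (F v)" if "word_cong Ih (artin_rels Ih mh) u v" for u v
    using \<Phi>F h.artin_class_eq[OF that] h.A_lists[OF that] F_I t.artin_class_eq_iff by metis
  have F_quasi_central: "t.quasi_central (\<Union>j\<in>J. set (g j)) (F u)" if u: "h.quasi_central J u" and J: "J \<subseteq> Ih" for J u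
    unfolding t.quasi_central_def
  proof (intro conjI ballI)
    show FuJ: "F u \<in> lists (\<Union>j\<in>J. set (g j))" using F_lists u by (simp add: h.quasi_central_def)
    fix a assume a: "a \<in> (\<Union>j\<in>J. set (g j))"
    then obtain j where j: "j \<in> J" "a \<in> set (g j)" by blast
    obtain j' where "word_cong Ih (artin_rels Ih mh) (j # u) (u @ [j'])"
      using u j by (auto simp: h.quasi_central_def)
    from F_cong[OF this] have "word_cong I (artin_rels I m) (g j @ F u) (F u @ g j')"
      by (simp add: F_def)
    \<comment> \<open>The exponent is positive since \<open>a\<close> occurs in \<open>g j\<close>;
      this is the form in which \<open>swap_of_power\<close> reduces the power of \<open>a\<close>
      to a single letter.\<close>
    moreover have "g j = replicate (Suc (length (g j) - 1)) a"
      using power[of j a] j J by (cases "g j") auto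
    ultimately obtain d where d: "word_cong I (artin_rels I m) (a # F u) (F u @ [d])"
      using t.swap_of_power by metis
    have "d \<in> (\<Union>j\<in>J. set (g j))"
      using t.A_set[OF d] a FuJ by (auto simp: in_lists_conv_set)
    then show "\<exists>d\<in>\<Union>j\<in>J. set (g j). word_cong I (artin_rels I m) (a # F u) (F u @ [d])" using d by blast
  qed
  have "\<Phi> x \<in> H" if x: "x \<in> parabolic_submonoid Ih mh Ih" and H: "submonoid H (artin_monoid I m)"
    "{artin_lift I m (parabolic_elt I m J C) | J C. C \<in> coxeter_components m K \<and> J \<subseteq> C} \<subseteq> H" for x H
  proof -
    interpret H: submonoid H "artin_monoid I m" by (rule H)
    \<comment> \<open>The hull is an intersection of submonoids, so an arbitrary \<open>H\<close>
      containing the target generators is fixed, and its preimage is shown to contain the source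
      generators.\<close>
    define H' where "H' = {x \<in> carrier (artin_monoid Ih mh). \<Phi> x \<in> H}"
    have H': "submonoid H' (artin_monoid Ih mh)"
    proof
      show "H' \<subseteq> carrier (artin_monoid Ih mh)" by (auto simp: H'_def)
      show "x \<otimes>\<^bsub>artin_monoid Ih mh\<^esub> y \<in> H'" if "x \<in> H'" "y \<in> H'" for x y
      proof -
        have "x \<otimes>\<^bsub>artin_monoid Ih mh\<^esub> y \<in> carrier (artin_monoid Ih mh)"
          using that h.artin_mult by (auto simp: H'_def h.artin_carrier)
        then show ?thesis using that assms(5) by (auto simp: H'_def hom_def)
      qed
      show "\<one>\<^bsub>artin_monoid Ih mh\<^esub> \<in> H'"
        using assms(6) by (auto simp: H'_def h.artin_carrier h.artin_one)
    qed
    have gens: "artin_lift Ih mh (parabolic_elt Ih mh J C) \<in> H'"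
      if C: "C \<in> coxeter_components mh Ih" and J: "J \<subseteq> C" for J C
    proof -
      have adjC: "h.adj_closed Ih C" using h.component_adj_closed C by blast
      then have CI: "C \<subseteq> Ih" by (simp add: h.adj_closed_def)
      have JI: "J \<subseteq> Ih" using J CI by blast
      obtain zJ where zJ: "h.longest J zJ" using h.ex_longest by blast
      obtain zC where zC: "h.longest C zC" using h.ex_longest by blast
      obtain zB where zB: "h.longest (Ih - C) zB" using h.ex_longest by blast
      have zBI: "zB \<in> lists Ih" using h.longest_reduced[OF zB] h.reduced_lists by blast
      have zCI: "zC \<in> lists Ih" using h.longest_reduced[OF zC] h.reduced_lists by blast
      have "h.ldvd zJ zC"
        using h.longest_ldvd[OF zJ JI zCI] h.longest_descent[OF zC CI] J by blast
      then obtain r where r: "word_cong Ih (artin_rels Ih mh) (zJ @ r) zC" "r \<in> lists Ih" by (metis h.ldvdE)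
      have lift: "artin_lift Ih mh (parabolic_elt Ih mh J C) = artin_class Ih mh r"
        using h.artin_lift_parabolic_elt[OF J CI zJ zC r(1)] .
      \<comment> \<open>Multiplication by \<open>zB\<close> leaves the quotient \<open>r\<close>
        unchanged and makes the right-hand side quasi-central for all of \<open>Ih\<close>.\<close>
      have "word_cong Ih (artin_rels Ih mh) ((zB @ zJ) @ r) (zB @ zC)"
        using h.A_left[OF r(1) zBI] by simp
      from F_cong[OF this] have prod: "word_cong I (artin_rels I m) (F (zB @ zJ) @ F r) (F (zB @ zC))"
        by (simp only: F_append)
      have "C \<union> (Ih - C) = Ih" using CI by blast
      then have qd: "t.quasi_central K (F (zB @ zC))"
        using F_quasi_central[OF h.quasi_central_component[OF adjC order_refl zC zB]] K by simp
      have "J \<union> (Ih - C) \<subseteq> Ih" using JI by blast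
      note qy = F_quasi_central[OF h.quasi_central_component[OF adjC J zJ zB] this]
      have "F r \<in> lists I \<and> artin_class I m (F r) \<in> H"
      proof (rule t.quasi_central_quotient[where P = "\<lambda>u. u \<in> lists I \<and> artin_class I m u \<in> H", OF KI _ _ _ _ qd qy _ prod])
        show "[] \<in> lists I \<and> artin_class I m [] \<in> H"
          using H.one_closed by (simp add: t.artin_one)
      next
        fix u v assume "u \<in> lists I \<and> artin_class I m u \<in> H" "v \<in> lists I \<and> artin_class I m v \<in> H"
        then show "u @ v \<in> lists I \<and> artin_class I m (u @ v) \<in> H"
          using H.m_closed t.artin_mult by (metis append_in_lists_conv)
      next
        fix u v assume "u \<in> lists I \<and> artin_class I m u \<in> H" "word_cong I (artin_rels I m) u v"
        then show "v \<in> lists I \<and> artin_class I m v \<in> H" using t.artin_class_eq t.A_lists by metis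
      next
        fix C J zJ zC r
        assume a: "C \<in> coxeter_components m K" "J \<subseteq> C" "t.longest J zJ" "t.longest C zC"
          "word_cong I (artin_rels I m) (zJ @ r) zC"
        have "C \<subseteq> I" using t.component_adj_closed[OF a(1)] KI by (auto simp: t.adj_closed_def)
        then have "artin_class I m r = artin_lift I m (parabolic_elt I m J C)"
          using t.artin_lift_parabolic_elt a by metis
        then show "r \<in> lists I \<and> artin_class I m r \<in> H"
          using H(2) a t.A_lists(1)[OF a(5)] by auto
      next
        show "(\<Union>j\<in>J \<union> (Ih - C). set (g j)) \<subseteq> K" using JI K by blast
      qed
      then show ?thesis unfolding lift H'_def using \<Phi>F r(2) by (auto simp: h.artin_carrier)
    qed
    have "parabolic_submonoid Ih mh Ih \<subseteq> H'"
      unfolding parabolic_submonoid_def using H' gens by (intro hull_minimal) auto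
    then show ?thesis using x by (auto simp: H'_def)
  qed
  then show ?thesis unfolding parabolic_hom_def K_def parabolic_submonoid_def[of I m] hull_def by blast
qed

end
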